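(* Let $m\ge4$ with $v_2(m)=1$, let $d=\frac{2^m-1}{3}$, and let $t$ be a positive integer with $\mathrm{lcm}(3,t)\mid(2^{\frac m2}+1)$ and $t\ne2^{\frac m2}+1$. Let $\gamma$ be a primitive element of $\mathbb{F}_{2^m}$, let $D=\langle\gamma^t\rangle$ be the subgroup of $\mathbb{F}_{2^m}^*$ generated by $\gamma^t$, let $f(x)=x^d$, and let $\mathcal{C}(f)^{\bar D}=\{(\mathrm{Tr}(ax^d+bx))_{x\in D}:a,b\in\mathbb{F}_{2^m}\}$. Then: (1) If $3\mid t$, then $\mathcal{C}(f)^{\bar D}$ is a $[\frac{2^m-1}{t},m+1]$ binary code with weight distribution: weight $0$ once; weight $\frac1{2t}(2^m-2-2^{\frac m2})$ with multiplicity $\frac{(t-1)(2^m-1)}{t}$; weight $\frac1{2t}(2^m+2^{\frac m2})$ with multiplicity $\frac{(t-1)(2^m-1)}{t}$; weight $\frac1{2t}(2^m-2+(t-1)2^{\frac m2})$ with multiplicity $\frac{2^m-1}{t}$; weight $\frac1{2t}(2^m-(t-1)2^{\frac m2})$ with multiplicity $\frac{2^m-1}{t}$; weight $\frac{2^m-1}{t}$ once. Its dual has parameters $[\frac{2^m-1}{t},\frac{2^m-1}{t}-m-1,4]$ and is distance-optimal with respect to the sphere packing bound. (2) If $3\nmid t$, then $\mathcal{C}(f)^{\bar D}$ is a $[\frac{2^m-1}{t},m+2]$ binary code with weight distribution: weight $0$ once; weight $\frac{2^m-1}{2t}-\frac1{2t}((t-1)2^{\frac m2}-1)$ with multiplicity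 $\frac{2^m-1}{t}$; weight $\frac{2^m-1}{2t}+\frac1{6t}((3t-1)2^{\frac m2}-1)$ with multiplicity $\frac{2^{m+1}-2}{t}$; weight $\frac1{2t}(2^m+2^{\frac m2})$ with multiplicity $\frac{(t-1)(2^m-1)}{t}$; weight $\frac{2^m-1}{2t}-\frac1{6t}(2^{\frac m2}+1)$ with multiplicity $\frac{3(t-1)(2^m-1)}{t}$; weight $\frac{2^m-1}{2t}-\frac1{6t}((3t+1)2^{\frac m2}+1)$ with multiplicity $\frac{2^m-1}{t}$; weight $\frac{2(2^m-1)}{3t}$ with multiplicity $3$. Its dual has parameters $[\frac{2^m-1}{t},\frac{2^m-1}{t}-m-2,3]$.
   Context: $\mathrm{Tr}$ is the absolute trace from $\mathbb{F}_{2^m}$ to $\mathbb{F}_2$; $v_2$ is the 2-adic order function. An $[n,k]$ (resp. $[n,k,d]$) binary code is a $k$-dimensional linear subspace of $\mathbb{F}_2^n$ (with minimum Hamming distance $d$); the dual is taken with respect to the standard inner product. The multiplicity of a weight is the number of codewords of that weight. An $[n,k,d]$ binary code is distance-optimal if there is no $[n,k,d']$ binary linear code with $d'\ge d+1$; the phrase "with respect to the sphere packing bound" asserts distance-optimality in this sense, and names the bound $2^n\ge 2^k\sum_{i=0}^{\lfloor (d-1)/2\rfloor}\binom ni$ (valid for every $[n,k,d]$ binary code) as the bound used to establish it. The notation $\mathcal{C}(f)^{\bar D}$ indicates puncturing on $\bar D=\mathbb{F}_{2^m}^*\setminus D$. *)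

theory Defs
  imports
    Complex_Main
    "HOL-Library.Function_Algebras"
    "HOL-Library.Z2"
    "HOL-Library.Cardinality"
    "HOL-Computational_Algebra.Primes"
begin

text \<open>
  The field $F_2$ is the type \<^typ>\<open>bit\<close>. For a finite coordinate set $I$, the space $F_2^I$ is
  represented by the functions from the coordinate type to \<^typ>\<open>bit\<close> that vanish outside $I$, so
  that equality of words is equality of functions.
\<close>

definition words :: "'i set \<Rightarrow> ('i \<Rightarrow> bit) set"
  where "words I = {u. \<forall>i. i \<notin> I \<longrightarrow> u i = 0}"

definition word_scale :: "bit \<Rightarrow> ('i \<Rightarrow> bit) \<Rightarrow> 'i \<Rightarrow> bit"
  where "word_scale c u = (\<lambda>i. c * u i)"

global_interpretation word: vector_space word_scale
  by standard (simp_all only: word_scale_def fun_eq_iff plus_fun_apply distrib_left distrib_right mult.assoc mult_1_left simp_thms)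

definition binary_code :: "'i set \<Rightarrow> nat \<Rightarrow> nat \<Rightarrow> ('i \<Rightarrow> bit) set \<Rightarrow> bool"
  where "binary_code I n k C \<longleftrightarrow>
    finite I \<and> card I = n \<and> C \<subseteq> words I \<and> word.subspace C \<and> word.dim C = k"

definition hamming_dist :: "'i set \<Rightarrow> ('i \<Rightarrow> bit) \<Rightarrow> ('i \<Rightarrow> bit) \<Rightarrow> nat"
  where "hamming_dist I u v = card {i \<in> I. u i \<noteq> v i}"

definition hamming_weight :: "'i set \<Rightarrow> ('i \<Rightarrow> bit) \<Rightarrow> nat"
  where "hamming_weight I u = card {i \<in> I. u i \<noteq> 0}"

text \<open>A code with at most one word has no minimum distance.\<close>

definition has_min_distance :: "'i set \<Rightarrow> ('i \<Rightarrow> bit) set \<Rightarrow> nat \<Rightarrow> bool"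
  where "has_min_distance I C \<delta> \<longleftrightarrow>
    (\<exists>u\<in>C. \<exists>v\<in>C. u \<noteq> v \<and> hamming_dist I u v = \<delta>) \<and>
    (\<forall>u\<in>C. \<forall>v\<in>C. u \<noteq> v \<longrightarrow> \<delta> \<le> hamming_dist I u v)"

definition binary_code_dist :: "'i set \<Rightarrow> nat \<Rightarrow> nat \<Rightarrow> nat \<Rightarrow> ('i \<Rightarrow> bit) set \<Rightarrow> bool"
  where "binary_code_dist I n k \<delta> C \<longleftrightarrow> binary_code I n k C \<and> has_min_distance I C \<delta>"

definition dual_code :: "'i set \<Rightarrow> ('i \<Rightarrow> bit) set \<Rightarrow> ('i \<Rightarrow> bit) set"
  where "dual_code I C = {u \<in> words I. \<forall>c\<in>C. (\<Sum>i\<in>I. u i * c i) = 0}"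

text \<open>
  The competing codes of length $n$ range over all linear codes in $F_2^n$, with coordinates
  $0, \ldots, n-1$.
\<close>

definition distance_optimal :: "'i set \<Rightarrow> ('i \<Rightarrow> bit) set \<Rightarrow> bool"
  where "distance_optimal I C \<longleftrightarrow>
    (\<exists>n k \<delta>. binary_code_dist I n k \<delta> C \<and>
      \<not> (\<exists>\<delta>' (C' :: (nat \<Rightarrow> bit) set). \<delta>' \<ge> \<delta> + 1 \<and> binary_code_dist {..<n} n k \<delta>' C'))"

text \<open>
  A weight distribution is given as a table of pairs (weight, multiplicity). Table rows are allowed
  to have multiplicity zero, and different rows can carry the same weight for particular
  parameters (then their multiplicities add up). Weights range over the reals so that a non-integral
  weight in the table is only possible if its multiplicity is zero.
\<close>

definition has_weight_distribution :: "'i set \<Rightarrow> ('i \<Rightarrow> bit) set \<Rightarrow> (real \<times> real) list \<Rightarrow> bool"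
  where "has_weight_distribution I C tab \<longleftrightarrow>
    (\<forall>w. real (card {c \<in> C. real (hamming_weight I c) = w}) =
      (\<Sum>(v, \<mu>) \<leftarrow> tab. if v = w then \<mu> else 0))"

text \<open>
  The absolute trace of the field with $2^m$ elements. The sum lies in the prime field, which is
  identified with \<^typ>\<open>bit\<close>; see the lemma below.
\<close>

definition abs_trace :: "nat \<Rightarrow> 'a::finite_field \<Rightarrow> bit"
  where "abs_trace m x = of_bool ((\<Sum>i<m. x ^ (2 ^ i)) = 1)"

lemma of_bit_abs_trace:
  fixes x :: "'a::finite_field"
  assumes card: "CARD('a) = 2 ^ m"
  shows "of_bit (abs_trace m x) = (\<Sum>i<m. x ^ (2 ^ i))"
proof -
  let ?s = "\<Sum>i<m. x ^ (2 ^ i)"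
  have "(\<Sum>y\<in>UNIV. y) = (\<Sum>y\<in>UNIV. y + (1 :: 'a))"
    by (rule sum.reindex_bij_witness[of _ "\<lambda>y. y + 1" "\<lambda>y. y - 1"]) auto
  then have "(of_nat CARD('a) :: 'a) = 0"
    by (simp add: sum.distrib)
  then have "CHAR('a) dvd 2 ^ m"
    using card by (simp only: of_nat_eq_0_iff_char_dvd)
  moreover have "prime CHAR('a)"
    by (rule prime_CHAR_semidom) (rule finite_imp_CHAR_pos, rule finite)
  ultimately have char: "CHAR('a) = 2"
    by (metis prime_dvd_power_nat primes_dvd_imp_eq two_is_prime_nat)
  have "?s ^ 2 = (\<Sum>i<m. (x ^ (2 ^ i)) ^ 2)"
    using freshmans_dream_sum[where 'a = 'a] char by simp
  also have "\<dots> = (\<Sum>i<m. x ^ (2 ^ Suc i))"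
    by (simp add: power_mult [symmetric] mult.commute)
  also have "\<dots> = ?s"
  proof -
    have "x ^ (2 ^ m) = x"
      using finite_field_power_card_eq_same[of x] card by simp
    then show ?thesis
      using sum.lessThan_Suc_shift[of "\<lambda>i. x ^ (2 ^ i)" m] sum.lessThan_Suc[of "\<lambda>i. x ^ (2 ^ i)" m]
      by (simp add: add.commute)
  qed
  finally have "?s * (?s - 1) = 0"
    by (simp add: algebra_simps power2_eq_square)
  then show ?thesis
    by (auto simp: abs_trace_def)
qed

definition cyclic_subgroup :: "'a::field \<Rightarrow> 'a set"
  where "cyclic_subgroup g = range (\<lambda>i::int. g powi i)"

definition primitive_element :: "'a::field \<Rightarrow> bool"
  where "primitive_element g \<longleftrightarrow> g \<noteq> 0 \<and> cyclic_subgroup g = UNIV - {0}"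

definition trace_code :: "nat \<Rightarrow> ('a::finite_field \<Rightarrow> 'a) \<Rightarrow> 'a set \<Rightarrow> ('a \<Rightarrow> bit) set"
  where "trace_code m f D =
    {(\<lambda>x. if x \<in> D then abs_trace m (a * f x + b * x) else 0) | a b. True}"

end

theory Submission
  imports Defs "HOL-Computational_Algebra.Polynomial"
begin

text \<open>
  Let \<open>Q = 2\<^sup>m\<^sup>/\<^sup>2\<close>. Since \<open>t\<close> divides \<open>Q + 1\<close>, the group \<open>D\<close> and its cubic classes are unions of
  cosets of the multiplicative group \<open>K\<close> of the subfield with \<open>Q\<close> elements. By transitivity of the
  trace, \<open>k \<mapsto> Tr (y k)\<close> vanishes on \<open>K\<close> if \<open>y \<in> K\<close> and otherwise takes the value 1 exactly
  \<open>Q / 2\<close> times. Hence the number of \<open>x\<close> in a union \<open>X\<close> of cosets of \<open>K\<close> with \<open>Tr (b x) = 1\<close>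
  depends only on the size of \<open>X\<close> and on whether \<open>1 / b \<in> X\<close>; no Gauss sums are needed. Moreover,
  \<open>Tr (a x\<^sup>d)\<close> is the indicator of such a union, because \<open>x\<^sup>d\<close> is constant on cosets of \<open>K\<close>.
  The minimum distance of the dual code comes from the sphere packing bound if \<open>3 dvd t\<close>, and
  otherwise from a linear relation over the subfield between elements of the three cubic classes.
\<close>

text \<open>Everything rests on divisibility by \<open>Q - 1\<close>. With
  \<open>s = (Q + 1) / t\<close> the group \<open>D\<close> has order \<open>(Q - 1) * s\<close>, so
  it consists of \<open>s\<close> cosets of \<open>K\<close>. Since 3 divides \<open>Q + 1\<close>,
  also \<open>Q - 1\<close> divides \<open>d\<close>. The condition on \<open>t\<close> says that
  \<open>s \<ge> 2\<close>; for \<open>s = 1\<close> the word of \<open>Tr x\<close> would vanish on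
  \<open>D = K\<close>. The pair (a, b) does not determine its code word: a acts only through the
  traces of its products with the values of x^d on \<open>D\<close>. These values are 1 alone if
  \<open>3 dvd t\<close>, and all three cube roots of unity otherwise. As the three roots add up to
  0, a contributes one bit in the first case and two in the second, which accounts for the
  dimensions m + 1 and m + 2. Words are therefore indexed by the set on which Tr(a x^d) is 1. If
  \<open>3 dvd t\<close>, the sphere packing bound serves twice: balls of radius 2 are too large for
  any code of the size of the dual, which excludes competitors of distance 5 or more and also forces
  a dual word of weight at most 4. This needs \<open>s \<ge> 3\<close>, which holds because
  \<open>s\<close> is odd.\<close>

section \<open>Binary codes\<close>

text \<open>The default rules turn sums of bits into \<open>of_bool\<close> of parity conditions.\<close>

declare add_bit_eq_xor [simp del] mult_bit_eq_and [simp del]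

lemma bit_add_eq_0_iff: "a + b = 0 \<longleftrightarrow> a = b" for a b :: bit
  by (cases a; cases b) simp_all

lemma word_add_self: "u + u = 0" for u :: "'i \<Rightarrow> bit"
  by (auto simp: fun_eq_iff bit_add_eq_0_iff)

lemma word_add_eq_0_iff: "u + v = 0 \<longleftrightarrow> u = v" for u v :: "'i \<Rightarrow> bit"
  by (auto simp: fun_eq_iff bit_add_eq_0_iff)

lemma word_subspaceI:
  assumes "0 \<in> S" "\<And>u v. u \<in> S \<Longrightarrow> v \<in> S \<Longrightarrow> u + v \<in> S"
  shows "word.subspace S"
proof (rule word.subspaceI)
  fix c :: bit and u assume "u \<in> S"
  then show "word_scale c u \<in> S"
    using assms(1) by (cases c) (simp_all add: word_scale_def zero_fun_def)
qed (use assms in auto)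

lemma finite_words: "finite I \<Longrightarrow> finite (words I)"
  and card_words: "finite I \<Longrightarrow> card (words I) = 2 ^ card I"
proof -
  assume I: "finite I"
  have bij: "bij_betw (\<lambda>T i. of_bool (i \<in> T)) (Pow I) (words I)"
    by (rule bij_betw_byWitness[where f' = "\<lambda>u. {i. u i = 1}"])
       (auto simp: words_def fun_eq_iff of_bool_def)
  from I show "finite (words I)"
    using bij_betw_finite[OF bij] by simp
  from I show "card (words I) = 2 ^ card I"
    using bij_betw_same_card[OF bij] by (simp add: card_Pow)
qed

section \<open>Cardinality and dimension over the field with two elements\<close>

lemma subspace_words: "word.subspace (words I)"
  by (rule word_subspaceI) (auto simp: words_def)

text \<open>Each new independent vector \<open>b\<close> doubles the span, because the translate of
  the old span by \<open>b\<close> is disjoint from it. Finiteness is carried along since the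
  cardinality of the union needs it.\<close>

lemma card_span_bit:
  assumes "finite B" "word.independent B"
  shows "card (word.span B) = 2 ^ card B \<and> finite (word.span B)"
  using assms
proof (induction B)
  case empty
  then show ?case by simp
next
  case (insert b B)
  then have b: "b \<notin> word.span B" and ind: "word.independent B"
    by (simp_all add: word.independent_insert)
  have span: "word.span (insert b B) = word.span B \<union> (+) b ` word.span B" (is "_ = ?S \<union> ?T")
  proof (intro subset_antisym subsetI)
    fix x assume "x \<in> word.span (insert b B)"
    then obtain c where "x - word_scale c b \<in> word.span B"
      by (auto simp: word.span_breakdown_eq)
    then show "x \<in> ?S \<union> ?T"
      by (cases c) (auto simp: word_scale_def image_iff intro!: bexI[of _ "x - b"]
          simp flip: zero_fun_def)
  next
    fix x assume "x \<in> ?S \<union> ?T"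
    then show "x \<in> word.span (insert b B)"
      using word.span_mono[of B "insert b B"] word.span_base[of b "insert b B"]
        word.span_add[of b "insert b B"] by auto
  qed
  have "?S \<inter> ?T = {}"
  proof -
    have "b \<in> word.span B" if "x \<in> word.span B" "b + x \<in> word.span B" for x
      using word.span_diff[OF that(2,1)] by simp
    then show ?thesis using b by auto
  qed
  moreover have "card ?T = card ?S"
    by (rule card_image) (auto simp: inj_on_def)
  ultimately show ?case
    using insert.IH[OF ind] insert.hyps by (simp add: span card_Un_disjoint)
qed

lemma card_subspace_bit:
  assumes "word.subspace S" "finite S"
  shows "card S = 2 ^ word.dim S"
proof -
  obtain B where B: "B \<subseteq> S" "word.independent B" "S \<subseteq> word.span B" "card B = word.dim S"
    by (rule word.basis_exists)
  have "word.span B = S"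
    using B(1,3) assms(1) word.span_minimal by blast
  then show ?thesis
    using card_span_bit[of B] B finite_subset[OF B(1) assms(2)] by simp
qed

lemma binary_codeI:
  assumes "finite I" "C \<subseteq> words I" "word.subspace C" "card C = 2 ^ k"
  shows "binary_code I (card I) k C"
  using assms card_subspace_bit[of C] finite_subset[OF assms(2) finite_words]
  by (simp add: binary_code_def)

text \<open>Stated for abelian groups because it is applied to field elements as well as to words.\<close>

lemma card_nonzero_functional:
  fixes \<phi> :: "'b::ab_group_add \<Rightarrow> bit"
  assumes fin: "finite S"
    and closed: "\<And>x y. x \<in> S \<Longrightarrow> y \<in> S \<Longrightarrow> x + y \<in> S" "\<And>x y. x \<in> S \<Longrightarrow> y \<in> S \<Longrightarrow> x - y \<in> S"
    and add: "\<And>x y. x \<in> S \<Longrightarrow> y \<in> S \<Longrightarrow> \<phi> (x + y) = \<phi> x + \<phi> y"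
    and s: "s \<in> S" "\<phi> s = 1"
  shows "2 * card {x \<in> S. \<phi> x = 1} = card S"
proof -
  have diff: "\<phi> (x - s) = \<phi> x + 1" if "x \<in> S" for x
  proof -
    have "\<phi> x = \<phi> (x - s) + \<phi> s"
      using add[OF closed(2)[OF that s(1)] s(1)] by simp
    then show ?thesis
      using s(2) by (cases "\<phi> (x - s)") auto
  qed
  \<comment> \<open>Translation by \<open>s\<close> exchanges the two fibres of \<phi>.\<close>
  have "bij_betw (\<lambda>x. x + s) {x \<in> S. \<phi> x = 0} {x \<in> S. \<phi> x = 1}"
    by (rule bij_betw_byWitness[where f' = "\<lambda>x. x - s"])
       (use closed s add diff in \<open>auto\<close>)
  then have "card {x \<in> S. \<phi> x = 0} = card {x \<in> S. \<phi> x = 1}"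
    by (rule bij_betw_same_card)
  moreover have "card S = card {x \<in> S. \<phi> x = 0} + card {x \<in> S. \<phi> x = 1}"
    using fin by (subst card_Un_disjoint[symmetric]) (auto intro!: arg_cong[where f = card])
  ultimately show ?thesis by simp
qed

section \<open>Dual codes\<close>

lemma dual_code_subset: "dual_code I C \<subseteq> words I"
  by (auto simp: dual_code_def)

lemma subspace_dual_code: "word.subspace (dual_code I C)"
  by (rule word_subspaceI) (auto simp: dual_code_def words_def distrib_right sum.distrib)

text \<open>Count the pairs of a word and a codeword with inner product 1 in two ways.\<close>

lemma card_dual_code:
  assumes I: "finite I" and C: "C \<subseteq> words I" "word.subspace C"
  shows "card (dual_code I C) * card C = 2 ^ card I"
proof -
  define ip :: "('a \<Rightarrow> bit) \<Rightarrow> ('a \<Rightarrow> bit) \<Rightarrow> bit" where "ip u c = (\<Sum>i\<in>I. u i * c i)" for u c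
  have ip_add: "ip (u + v) c = ip u c + ip v c" "ip u (c + c') = ip u c + ip u c'" for u v c c'
    by (simp_all add: ip_def distrib_left distrib_right sum.distrib)
  have finW: "finite (words I)" and cardW: "card (words I) = 2 ^ card I"
    using I by (simp_all add: finite_words card_words)
  have finC: "finite C" using finite_subset[OF C(1) finW] .
  have dual: "dual_code I C = {u \<in> words I. \<forall>c\<in>C. ip u c = 0}"
    by (simp add: dual_code_def ip_def)
  have row: "2 * card {c \<in> C. ip u c = 1} = (if u \<in> dual_code I C then 0 else card C)"
    if "u \<in> words I" for u
  proof (cases "u \<in> dual_code I C")
    case True
    then have empty: "{c \<in> C. ip u c = 1} = {}" by (auto simp: dual)
    show ?thesis unfolding empty using True by simp
  next
    case False
    with that obtain c where "c \<in> C" "ip u c = 1" by (auto simp: dual)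
    then show ?thesis
      using False card_nonzero_functional[OF finC, of "ip u" c] C(2)
      by (simp add: word.subspace_add word.subspace_diff ip_add)
  qed
  have col: "2 * card {u \<in> words I. ip u c = 1} = (if c = 0 then 0 else 2 ^ card I)"
    if c: "c \<in> C" for c
  proof (cases "c = 0")
    case True
    then show ?thesis by (simp add: ip_def)
  next
    case False
    then obtain i where i: "c i = 1" by (auto simp: fun_eq_iff)
    then have "i \<in> I" using c C(1) unfolding words_def by force
    let ?e = "\<lambda>j. of_bool (j = i) :: bit"
    have "?e \<in> words I" using \<open>i \<in> I\<close> by (auto simp: words_def)
    moreover have "ip ?e c = 1"
      using i \<open>i \<in> I\<close> I by (simp add: ip_def of_bool_def if_distrib[of "\<lambda>x. x * _"] cong: if_cong)
    ultimately show ?thesis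
      using False card_nonzero_functional[OF finW, of "\<lambda>u. ip u c" ?e] subspace_words[of I]
      by (simp add: word.subspace_add word.subspace_diff ip_add cardW)
  qed
  have "(\<Sum>u\<in>words I. \<Sum>c\<in>C. of_bool (ip u c = 1) :: nat) = (\<Sum>c\<in>C. \<Sum>u\<in>words I. of_bool (ip u c = 1))"
    by (rule sum.swap)
  then have "(\<Sum>u\<in>words I. card {c \<in> C. ip u c = 1}) = (\<Sum>c\<in>C. card {u \<in> words I. ip u c = 1})"
    using finW finC by (simp add: Int_def)
  then have "(\<Sum>u\<in>words I. 2 * card {c \<in> C. ip u c = 1}) = (\<Sum>c\<in>C. 2 * card {u \<in> words I. ip u c = 1})"
    by (simp flip: sum_distrib_left)
  then have "(\<Sum>u\<in>words I. if u \<in> dual_code I C then 0 else card C) = (\<Sum>c\<in>C. if c = 0 then 0 else 2 ^ card I)"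
    by (simp add: row col)
  moreover have "(\<Sum>u\<in>words I. if u \<in> dual_code I C then 0 else card C) = (2 ^ card I - card (dual_code I C)) * card C"
    using finW dual_code_subset[of I C] finite_subset[OF dual_code_subset finW, of C]
    by (simp add: sum.If_cases Int_def Diff_eq[symmetric] card_Diff_subset cardW
        flip: Collect_neg_eq set_diff_eq)
  moreover have "(\<Sum>c\<in>C. if c = 0 then 0 else 2 ^ card I) = (card C - 1) * (2 ^ card I :: nat)"
    using finC word.subspace_0[OF C(2)]
    by (simp add: sum.If_cases Diff_eq[symmetric])
  ultimately have "(2 ^ card I - card (dual_code I C)) * card C = (card C - 1) * 2 ^ card I"
    by simp
  moreover have "card (dual_code I C) \<le> 2 ^ card I"
    using card_mono[OF finW dual_code_subset[of I C]] cardW by simp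
  moreover have "card C \<ge> 1"
    using word.subspace_0[OF C(2)] finC by (metis One_nat_def Suc_leI card_gt_0_iff empty_iff)
  \<comment> \<open>The truncated subtractions move to the integers, where the common term
    \<open>2 ^ card I * card C\<close> cancels.\<close>
  ultimately have "int (2 ^ card I - card (dual_code I C)) * int (card C) = int (card C - 1) * 2 ^ card I"
    by (metis of_nat_mult of_nat_numeral of_nat_power)
  then have "int (card (dual_code I C) * card C) = int (2 ^ card I)"
    using \<open>card (dual_code I C) \<le> 2 ^ card I\<close> \<open>card C \<ge> 1\<close>
    by (simp add: of_nat_diff algebra_simps)
  then show ?thesis by (simp only: of_nat_eq_iff)
qed

lemma
  assumes "finite I" "C \<subseteq> words I" "word.subspace C" "card C = 2 ^ k"
  shows dim_le_length: "k \<le> card I"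
    and binary_code_dual: "binary_code I (card I) (card I - k) (dual_code I C)"
proof -
  have dual: "card (dual_code I C) * 2 ^ k = 2 ^ card I"
    using card_dual_code[OF assms(1-3)] assms(4) by simp
  then have "(2::nat) ^ k dvd 2 ^ card I"
    by (metis dvd_triv_right)
  then show k: "k \<le> card I"
    by (simp add: power_dvd_imp_le)
  then have "(2::nat) ^ card I = 2 ^ (card I - k) * 2 ^ k"
    by (simp flip: power_add)
  with dual have "card (dual_code I C) = 2 ^ (card I - k)"
    by simp
  then show "binary_code I (card I) (card I - k) (dual_code I C)"
    using assms(1) by (intro binary_codeI dual_code_subset subspace_dual_code)
qed

section \<open>Minimum distance and the sphere packing bound\<close>

lemma hamming_dist_eq_weight: "hamming_dist I u v = hamming_weight I (u + v)"
proof -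
  have "{i \<in> I. u i \<noteq> v i} = {i \<in> I. (u + v) i \<noteq> 0}"
    by (auto simp del: bit_not_zero_iff simp: bit_add_eq_0_iff)
  then show ?thesis by (simp add: hamming_dist_def hamming_weight_def)
qed

lemma has_min_distanceI:
  assumes "word.subspace C" "u \<in> C" "u \<noteq> 0" "hamming_weight I u = \<delta>"
    and "\<And>v. v \<in> C \<Longrightarrow> v \<noteq> 0 \<Longrightarrow> \<delta> \<le> hamming_weight I v"
  shows "has_min_distance I C \<delta>"
  unfolding has_min_distance_def hamming_dist_eq_weight
proof (intro conjI ballI impI)
  show "\<exists>u\<in>C. \<exists>v\<in>C. u \<noteq> v \<and> hamming_weight I (u + v) = \<delta>"
    using assms(2-4) word.subspace_0[OF assms(1)] by (intro bexI[of _ u] bexI[of _ 0]) auto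
  show "\<delta> \<le> hamming_weight I (x + y)" if "x \<in> C" "y \<in> C" "x \<noteq> y" for x y
    using assms(5)[of "x + y"] that word.subspace_add[OF assms(1)] by (simp add: word_add_eq_0_iff)
qed

text \<open>A point of the ball around \<open>u\<close> is encoded by its set \<open>T\<close> of
  error positions. If \<open>u\<close> with errors \<open>T\<close> equals \<open>v\<close> with
  errors \<open>T'\<close>, then \<open>u\<close> and \<open>v\<close> differ only on
  \<open>T \<union> T'\<close>, hence in at most \<open>2 * e\<close> places; so the balls are
  disjoint.\<close>

theorem sphere_packing_bound:
  assumes I: "finite I" and C: "C \<subseteq> words I"
    and dist: "\<And>u v. u \<in> C \<Longrightarrow> v \<in> C \<Longrightarrow> u \<noteq> v \<Longrightarrow> 2 * e < hamming_dist I u v"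
  shows "card C * (\<Sum>i\<le>e. card I choose i) \<le> 2 ^ card I"
proof -
  define \<B> where "\<B> = {T. T \<subseteq> I \<and> card T \<le> e}"
  define ind :: "'a set \<Rightarrow> 'a \<Rightarrow> bit" where "ind T i = of_bool (i \<in> T)" for T i
  have "\<B> = (\<Union>i\<le>e. {T. T \<subseteq> I \<and> card T = i})"
    by (auto simp: \<B>_def)
  then have "card \<B> = (\<Sum>i\<le>e. card {T. T \<subseteq> I \<and> card T = i})"
    using I by (simp add: card_UN_disjoint disjoint_iff)
  then have card\<B>: "card \<B> = (\<Sum>i\<le>e. card I choose i)"
    using I by (simp add: n_subsets)
  have "inj_on (\<lambda>(u, T). u + ind T) (C \<times> \<B>)"
  proof (rule inj_onI, clarsimp)
    fix u T v T' assume *: "u \<in> C" "v \<in> C" "T \<in> \<B>" "T' \<in> \<B>" and eq: "u + ind T = v + ind T'"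
    have "u = v"
    proof (rule ccontr)
      assume "u \<noteq> v"
      have "{i \<in> I. u i \<noteq> v i} \<subseteq> T \<union> T'"
      proof clarify
        fix i assume "u i \<noteq> v i" "i \<notin> T'"
        with fun_cong[OF eq, of i] show "i \<in> T"
          by (cases "u i"; cases "v i") (auto simp: ind_def of_bool_def split: if_splits)
      qed
      then have "hamming_dist I u v \<le> card (T \<union> T')"
        unfolding hamming_dist_def using * I
        by (intro card_mono) (auto simp: \<B>_def dest: finite_subset)
      also have "\<dots> \<le> card T + card T'" by (rule card_Un_le)
      also have "\<dots> \<le> 2 * e" using * by (simp add: \<B>_def)
      finally show False using dist[OF *(1,2) \<open>u \<noteq> v\<close>] by simp
    qed
    with eq have "ind T = ind T'" by simp
    then have "T = T'" by (auto simp: ind_def fun_eq_iff of_bool_eq_iff)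
    with \<open>u = v\<close> show "u = v \<and> T = T'" by simp
  qed
  moreover have "(\<lambda>(u, T). u + ind T) ` (C \<times> \<B>) \<subseteq> words I"
  proof clarify
    fix u T assume "u \<in> C" "T \<in> \<B>"
    then have "u \<in> words I" "ind T \<in> words I"
      using C by (auto simp: words_def ind_def \<B>_def)
    then show "u + ind T \<in> words I"
      by (rule word.subspace_add[OF subspace_words])
  qed
  ultimately have "card (C \<times> \<B>) \<le> card (words I)"
    using card_inj_on_le finite_words[OF I] by blast
  then show ?thesis
    using card_words[OF I] by (simp add: card_cartesian_product card\<B>)
qed

section \<open>Trace and roots of unity in binary fields\<close>

text \<open>Translation by 1 permutes the field and so preserves the sum of all its elements; hence
  the characteristic divides the number of elements.\<close>

lemma CHAR_eq_2:
  assumes "CARD('a::finite_field) = 2 ^ m"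
  shows "CHAR('a) = 2"
proof -
  have "(\<Sum>y\<in>UNIV. y) = (\<Sum>y\<in>UNIV. y + (1 :: 'a))"
    by (rule sum.reindex_bij_witness[of _ "\<lambda>y. y + 1" "\<lambda>y. y - 1"]) auto
  then have "(of_nat CARD('a) :: 'a) = 0"
    by (simp add: sum.distrib)
  then have "CHAR('a) dvd 2 ^ m"
    using assms by (simp only: of_nat_eq_0_iff_char_dvd)
  moreover have "prime CHAR('a)"
    by (rule prime_CHAR_semidom) (rule finite_imp_CHAR_pos, rule finite)
  ultimately show ?thesis
    by (metis prime_dvd_power_nat primes_dvd_imp_eq two_is_prime_nat)
qed

text \<open>The linearized polynomial \<open>p\<close> has degree at most
  \<open>2 ^ (h - 1)\<close>, and its coefficient there is a power of \<open>z\<close>, hence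
  nonzero; it cannot vanish on more points than its degree. The bound is applied to the whole field
  and to the subfield.\<close>

lemma exists_linearized_nonzero:
  fixes z :: "'a::field"
  assumes "h > 0" "z \<noteq> 0" "finite S" "card S > 2 ^ (h - 1)"
  shows "\<exists>k\<in>S. (\<Sum>i<h. (z * k) ^ (2 ^ i)) \<noteq> 0"
proof (rule ccontr)
  assume "\<not> ?thesis"
  then have zero: "(\<Sum>i<h. (z * k) ^ (2 ^ i)) = 0" if "k \<in> S" for k
    using that by blast
  define p where "p = (\<Sum>i<h. monom (z ^ (2 ^ i)) (2 ^ i))"
  have "coeff p (2 ^ (h - 1)) = (\<Sum>i<h. if i = h - 1 then z ^ (2 ^ i) else 0)"
    by (simp add: p_def coeff_sum)
  also have "\<dots> \<noteq> 0"
    using assms(1,2) by simp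
  finally have "p \<noteq> 0" by auto
  have "degree p \<le> 2 ^ (h - 1)"
    unfolding p_def
    by (rule degree_sum_le) (auto intro!: order_trans[OF degree_monom_le] power_increasing)
  have "poly p k = (\<Sum>i<h. (z * k) ^ (2 ^ i))" for k
    by (simp add: p_def poly_sum poly_monom power_mult_distrib)
  then have "S \<subseteq> {k. poly p k = 0}"
    using zero by auto
  then have "card S \<le> card {k. poly p k = 0}"
    using \<open>p \<noteq> 0\<close> by (intro card_mono poly_roots_finite)
  also have "\<dots> \<le> degree p"
    by (rule card_poly_roots_bound) fact
  finally show False
    using \<open>degree p \<le> _\<close> assms(4) by linarith
qed

locale binary_field =
  fixes m :: nat and field_type :: "'a::finite_field itself"
  assumes card_field: "CARD('a) = 2 ^ m"
begin

abbreviation Tr :: "'a \<Rightarrow> bit" where "Tr \<equiv> abs_trace m"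

lemma CHAR_2: "CHAR('a) = 2"
  by (rule CHAR_eq_2) (rule card_field)

lemma add_self: "x + x = 0" for x :: 'a
proof -
  have "(of_nat 2 :: 'a) = 0"
    by (subst of_nat_eq_0_iff_char_dvd) (simp add: CHAR_2)
  then have "(1 + 1 :: 'a) = 0" by simp
  then show ?thesis by (metis distrib_left mult_1_right mult_zero_right)
qed

lemma add_eq_0_iff_eq: "x + y = 0 \<longleftrightarrow> x = y" for x y :: 'a
  by (metis add_self add_left_cancel)

lemma power_two_add: "(x + y) ^ (2 ^ i) = x ^ (2 ^ i) + y ^ (2 ^ i)" for x y :: 'a
  by (rule freshmans_dream'[where n = i]) (simp_all add: CHAR_2)

lemma trace_eq_iff: "Tr x = 1 \<longleftrightarrow> (\<Sum>i<m. x ^ (2 ^ i)) \<noteq> 0"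
  using of_bit_abs_trace[OF card_field, of x] by (cases "Tr x") auto

lemma trace_add: "Tr (x + y) = Tr x + Tr y"
proof -
  have "of_bit (Tr (x + y)) = (of_bit (Tr x) + of_bit (Tr y) :: 'a)"
    by (simp only: of_bit_abs_trace[OF card_field] power_two_add sum.distrib)
  then show ?thesis
    by (cases "Tr x"; cases "Tr y"; cases "Tr (x + y)") (auto simp: add_self)
qed

lemma trace_0 [simp]: "Tr 0 = 0"
  using trace_add[of 0 0] by (cases "Tr 0") auto

lemma trace_sum: "Tr (\<Sum>x\<in>A. f x) = (\<Sum>x\<in>A. Tr (f x))"
  by (induction A rule: infinite_finite_induct) (simp_all add: trace_add)

lemma m_pos: "m > 0"
proof (rule ccontr)
  assume "\<not> m > 0"
  then have "CARD('a) = 1" using card_field by simp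
  then have "is_singleton (UNIV :: 'a set)" by (simp add: is_singleton_altdef)
  then show False
    by (metis UNIV_I is_singletonE singletonD zero_neq_one)
qed

lemma card_units_pos: "0 < 2 ^ m - (1 :: nat)"
  using one_less_power[of "2 :: nat" m] m_pos by simp

lemma trace_nondegenerate:
  assumes "y \<noteq> 0"
  obtains b where "Tr (b * y) = 1"
proof -
  have "\<exists>k\<in>UNIV. (\<Sum>i<m. (y * k) ^ (2 ^ i)) \<noteq> 0"
    using m_pos assms by (intro exists_linearized_nonzero) (simp_all add: card_field)
  then show ?thesis
    using that by (auto simp: trace_eq_iff mult.commute)
qed

end

locale primitive_binary_field = binary_field m field_type
  for m :: nat and field_type :: "'a::finite_field itself" +
  fixes \<gamma> :: 'a
  assumes primitive: "primitive_element \<gamma>"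
begin

lemma \<gamma>_nonzero: "\<gamma> \<noteq> 0"
  using primitive by (simp add: primitive_element_def)

lemma nonzero_power: "x ^ (2 ^ m - 1) = 1" if "x \<noteq> 0" for x :: 'a
proof -
  have "x * x ^ (2 ^ m - 1) = x * 1"
    using finite_field_power_card_eq_same[of x] card_field by (simp flip: power_Suc)
  with that show ?thesis by (metis mult_left_cancel)
qed

text \<open>Reducing integer exponents modulo \<open>2 ^ m - 1\<close> gives surjectivity;
  injectivity then follows by counting.\<close>

lemma bij_betw_\<gamma>_power: "bij_betw (\<lambda>i. \<gamma> ^ i) {..<2 ^ m - 1} (UNIV - {0})"
proof -
  have surj: "UNIV - {0} \<subseteq> (\<lambda>i. \<gamma> ^ i) ` {..<2 ^ m - 1}"
  proof
    fix x assume "x \<in> UNIV - {0 :: 'a}"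
    then obtain i :: int where i: "x = \<gamma> powi i"
      using primitive unfolding primitive_element_def cyclic_subgroup_def by blast
    define n :: int where "n = 2 ^ m - 1"
    have "n > 0" using m_pos by (simp add: n_def)
    then have nat_n: "nat n = 2 ^ m - 1"
      by (simp add: n_def nat_diff_distrib nat_power_eq)
    have "\<gamma> powi i = \<gamma> powi (n * (i div n) + i mod n)" by simp
    also have "\<dots> = (\<gamma> powi n) powi (i div n) * \<gamma> powi (i mod n)"
      using \<gamma>_nonzero by (simp only: power_int_add power_int_mult simp_thms)
    also have "\<gamma> powi n = 1"
      using nonzero_power[OF \<gamma>_nonzero] \<open>n > 0\<close> nat_n by (simp add: power_int_def)
    also have "1 powi (i div n) * \<gamma> powi (i mod n) = \<gamma> ^ nat (i mod n)"
      using \<open>n > 0\<close> by (simp add: power_int_def)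
    finally have "x = \<gamma> ^ nat (i mod n)" using i by simp
    moreover have "nat (i mod n) < 2 ^ m - 1"
      using \<open>n > 0\<close> nat_n by (metis nat_mono_iff pos_mod_bound)
    ultimately show "x \<in> (\<lambda>i. \<gamma> ^ i) ` {..<2 ^ m - 1}" by blast
  qed
  then have image: "(\<lambda>i. \<gamma> ^ i) ` {..<2 ^ m - 1} = UNIV - {0}"
    using \<gamma>_nonzero by auto
  moreover have "card (UNIV - {0 :: 'a}) = 2 ^ m - 1"
    by (simp add: card_Diff_singleton card_field)
  ultimately have "inj_on (\<lambda>i. \<gamma> ^ i) {..<2 ^ m - 1}"
    by (intro eq_card_imp_inj_on) simp_all
  with image show ?thesis by (simp add: bij_betw_def)
qed

lemma \<gamma>_power_eq_1_iff: "\<gamma> ^ i = 1 \<longleftrightarrow> (2 ^ m - 1) dvd i"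
proof -
  have "\<gamma> ^ i = \<gamma> ^ (i mod (2 ^ m - 1))"
  proof -
    have "\<gamma> ^ i = \<gamma> ^ ((2 ^ m - 1) * (i div (2 ^ m - 1)) + i mod (2 ^ m - 1))" by simp
    also have "\<dots> = \<gamma> ^ (i mod (2 ^ m - 1))"
      by (simp only: power_add power_mult nonzero_power[OF \<gamma>_nonzero] power_one mult_1)
    finally show ?thesis .
  qed
  then have "\<gamma> ^ i = 1 \<longleftrightarrow> \<gamma> ^ (i mod (2 ^ m - 1)) = \<gamma> ^ 0" by simp
  also have "\<dots> \<longleftrightarrow> i mod (2 ^ m - 1) = 0"
    using bij_betw_\<gamma>_power card_units_pos by (auto simp: bij_betw_def inj_on_def simp del: power_0)
  finally show ?thesis by (simp add: dvd_eq_mod_eq_0)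
qed

text \<open>For \<open>x = \<gamma> ^ j\<close>, the equation \<open>x ^ n = 1\<close> means that
  \<open>n * s\<close> divides \<open>j * n\<close>, that is, \<open>s dvd j\<close>. This describes
  \<open>K\<close>, \<open>D\<close> and the cube roots of unity alike.\<close>

lemma roots_of_unity_eq:
  assumes "n * s = 2 ^ m - 1"
  shows "{x :: 'a. x ^ n = 1} = (\<lambda>i. \<gamma> ^ (s * i)) ` {..<n}"
    and "card {x :: 'a. x ^ n = 1} = n"
proof -
  have "n * s > 0"
    unfolding assms by (rule card_units_pos)
  then have pos: "n > 0" "s > 0" by simp_all
  show eq: "{x :: 'a. x ^ n = 1} = (\<lambda>i. \<gamma> ^ (s * i)) ` {..<n}"
  proof (intro subset_antisym subsetI; clarify)
    fix x :: 'a assume x: "x ^ n = 1"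
    have "x \<noteq> 0"
    proof
      assume "x = 0"
      with x have "0 ^ n = (1 :: 'a)" by simp
      with pos(1) show False by (simp add: zero_power)
    qed
    then have "x \<in> (\<lambda>i. \<gamma> ^ i) ` {..<2 ^ m - 1}"
      using bij_betw_imp_surj_on[OF bij_betw_\<gamma>_power] by simp
    then obtain j where j: "j < 2 ^ m - 1" "x = \<gamma> ^ j"
      by blast
    have "\<gamma> ^ (j * n) = 1"
      using x unfolding j(2) power_mult .
    then have "n * s dvd j * n"
      unfolding \<gamma>_power_eq_1_iff assms .
    then have "s dvd j" using pos(1) by (simp add: mult.commute[of j])
    then obtain i where "j = s * i" by blast
    moreover from this have "i < n"
      using j(1) pos(2) unfolding assms[symmetric] mult.commute[of n] by simp
    ultimately show "x \<in> (\<lambda>i. \<gamma> ^ (s * i)) ` {..<n}" using j by blast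
  next
    fix i
    have "(\<gamma> ^ (s * i)) ^ n = (\<gamma> ^ (n * s)) ^ i"
      by (simp add: mult_ac flip: power_mult)
    then show "(\<gamma> ^ (s * i)) ^ n = 1"
      using assms nonzero_power[OF \<gamma>_nonzero] by simp
  qed
  have "inj_on (\<lambda>i. \<gamma> ^ (s * i)) {..<n}"
  proof (rule inj_onI)
    fix i j assume ij: "i \<in> {..<n}" "j \<in> {..<n}" and "\<gamma> ^ (s * i) = \<gamma> ^ (s * j)"
    moreover have "s * i < 2 ^ m - 1" "s * j < 2 ^ m - 1"
      using ij pos(2) unfolding assms[symmetric] mult.commute[of n] by simp_all
    ultimately have "s * i = s * j"
      by (intro inj_onD[OF bij_betw_imp_inj_on[OF bij_betw_\<gamma>_power]]) (simp_all only: lessThan_iff)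
    then show "i = j" using pos by simp
  qed
  then show "card {x :: 'a. x ^ n = 1} = n"
    by (simp add: eq card_image)
qed

text \<open>Replaces integer powers of a generator by an equation, from which closure properties can
  be read off.\<close>

lemma cyclic_subgroup_eq:
  assumes "n * s = 2 ^ m - 1"
  shows "cyclic_subgroup (\<gamma> ^ s) = {x :: 'a. x ^ n = 1}"
proof (intro subset_antisym subsetI)
  fix x assume "x \<in> cyclic_subgroup (\<gamma> ^ s)"
  then obtain i :: int where "x = (\<gamma> ^ s) powi i"
    unfolding cyclic_subgroup_def by blast
  then have "x ^ n = ((\<gamma> ^ s) powi i) ^ n" by simp
  also have "\<dots> = ((\<gamma> ^ s) ^ n) powi i"
    unfolding power_int_power' power_int_power[of "\<gamma> ^ s"] by (simp only: mult.commute)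
  also have "(\<gamma> ^ s) ^ n = 1"
    using nonzero_power[OF \<gamma>_nonzero] by (simp add: mult.commute[of s n] assms flip: power_mult)
  finally show "x \<in> {x. x ^ n = 1}" by simp
next
  fix x :: 'a assume "x \<in> {x. x ^ n = 1}"
  then obtain i where "x = \<gamma> ^ (s * i)"
    unfolding roots_of_unity_eq(1)[OF assms] by blast
  then have "x = (\<gamma> ^ s) powi int i"
    by (simp only: power_mult power_int_of_nat)
  then show "x \<in> cyclic_subgroup (\<gamma> ^ s)"
    unfolding cyclic_subgroup_def by (rule range_eqI)
qed

end

section \<open>Sets stable under the quadratic subfield\<close>

lemma sum_lessThan_add: "(\<Sum>i<m + n. f i) = (\<Sum>i<m. f i) + (\<Sum>i<n. f (m + i))"
  for f :: "nat \<Rightarrow> 'b::comm_monoid_add"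
  by (induction n) (simp_all add: add.assoc)

locale quadratic_binary_field = primitive_binary_field m field_type \<gamma>
  for m :: nat and field_type :: "'a::finite_field itself" and \<gamma> :: 'a +
  fixes h :: nat
  assumes m_eq: "m = 2 * h" and h_ge: "h \<ge> 2"
begin

definition Q :: nat where "Q = 2 ^ h"

lemma Q_ge: "Q \<ge> 4"
  using power_increasing[OF h_ge, of "2 :: nat"] by (simp add: Q_def)

lemma card_units: "2 ^ m - 1 = (Q - 1) * (Q + 1)"
proof -
  have "(a - 1) * (a + 1) = a * a - 1" for a :: nat
    by (cases a) simp_all
  then show ?thesis
    by (simp only: Q_def m_eq mult_2 power_add)
qed

definition K :: "'a set" where "K = {x. x ^ (Q - 1) = 1}"

lemma card_K: "card K = Q - 1"
  unfolding K_def by (rule roots_of_unity_eq(2)[of _ "Q + 1"]) (simp only: card_units)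

lemma mem_K_iff: "x \<in> K \<longleftrightarrow> x \<noteq> 0 \<and> x ^ Q = x"
proof (cases "x = 0")
  case True
  have "(0 :: 'a) ^ (Q - 1) = 0" using Q_ge by (intro zero_power) simp
  with True show ?thesis by (simp only: K_def mem_Collect_eq zero_neq_one simp_thms)
next
  case False
  have "x ^ Q = x * x ^ (Q - 1)"
    using Q_ge by (simp flip: power_Suc)
  then have "x ^ Q = x \<longleftrightarrow> x * x ^ (Q - 1) = x * 1" by simp
  with False show ?thesis by (simp only: K_def mult_left_cancel mem_Collect_eq simp_thms)
qed

lemma K_mult: "x \<in> K \<Longrightarrow> y \<in> K \<Longrightarrow> x * y \<in> K"
  by (simp add: mem_K_iff power_mult_distrib)

lemma K_inverse: "x \<in> K \<Longrightarrow> inverse x \<in> K"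
  by (simp add: mem_K_iff power_inverse)

lemma Q_power_add: "(x + y) ^ Q = x ^ Q + y ^ Q" for x y :: 'a
  unfolding Q_def by (rule power_two_add)

lemma mem_subfield_iff: "x \<in> insert 0 K \<longleftrightarrow> x ^ Q = x"
  using Q_ge by (auto simp: mem_K_iff zero_power)

lemma subfield_diff: "x \<in> insert 0 K \<Longrightarrow> y \<in> insert 0 K \<Longrightarrow> x - y \<in> insert 0 K"
proof -
  assume xy: "x \<in> insert 0 K" "y \<in> insert 0 K"
  have "(x - y) ^ Q + y ^ Q = x ^ Q"
    by (simp only: Q_power_add[symmetric] diff_add_cancel)
  with xy have "(x - y) ^ Q + y = x"
    by (simp only: mem_subfield_iff)
  then have "(x - y) ^ Q = x - y"
    by (metis add_diff_cancel_right')
  then show ?thesis by (simp only: mem_subfield_iff)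
qed

lemma card_subfield: "card (insert 0 K) = Q"
proof -
  have "0 \<notin> K" by (simp add: mem_K_iff)
  then show ?thesis using Q_ge by (simp add: card_K)
qed

text \<open>Transitivity of the trace: \<open>x + x ^ Q\<close> is the relative trace to the
  subfield, and the outer sum is the trace of the subfield. The exponents below \<open>2 * h\<close>
  split into two halves that differ by a Q-th power.\<close>

lemma trace_eq_relative: "Tr x = 1 \<longleftrightarrow> (\<Sum>i<h. (x + x ^ Q) ^ (2 ^ i)) \<noteq> 0"
proof -
  have "(\<Sum>i<m. x ^ (2 ^ i)) = (\<Sum>i<h. (x + x ^ Q) ^ (2 ^ i))"
    unfolding Q_def m_eq mult_2 sum_lessThan_add
    by (simp only: power_two_add sum.distrib power_add power_mult)
  then show ?thesis by (simp only: trace_eq_iff)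
qed

text \<open>For \<open>k \<in> K\<close> the relative trace of \<open>y * k\<close> is
  \<open>(y + y ^ Q) * k\<close>. It is 0 if \<open>y\<close> lies in the subfield. Otherwise the
  polynomial of degree at most \<open>Q / 2\<close> cannot vanish on all \<open>Q\<close> elements
  of the subfield, so the functional is nonzero and balanced there; dropping 0 loses no element of
  trace 1.\<close>

lemma card_trace_K: "2 * card {k \<in> K. Tr (y * k) = 1} = (if y ^ Q = y then 0 else Q)"
proof (cases "y ^ Q = y")
  case True
  have "Tr (y * k) \<noteq> 1" if "k \<in> K" for k
  proof -
    have "(y * k) ^ Q = y * k"
      using that True by (simp add: power_mult_distrib mem_K_iff)
    then show ?thesis
      unfolding trace_eq_relative by (simp add: add_self power_0_left)
  qed
  then show ?thesis using True by (simp add: card_eq_0_iff)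
next
  case False
  define z where "z = y + y ^ Q"
  have "z \<noteq> 0" using False add_eq_0_iff_eq[of y "y ^ Q"] by (auto simp: z_def)
  define F where "F = insert 0 K"
  have F: "x \<in> F \<longleftrightarrow> x ^ Q = x" for x
    unfolding F_def by (rule mem_subfield_iff)
  have "card F = Q"
    unfolding F_def by (rule card_subfield)
  moreover have "(2 :: nat) ^ (h - 1) < Q"
    unfolding Q_def using h_ge by (intro power_strict_increasing) auto
  ultimately have "\<exists>k\<in>F. (\<Sum>i<h. (z * k) ^ (2 ^ i)) \<noteq> 0"
    using h_ge by (intro exists_linearized_nonzero \<open>z \<noteq> 0\<close>) simp_all
  then obtain k where k: "k \<in> F" "(\<Sum>i<h. (z * k) ^ (2 ^ i)) \<noteq> 0"
    by blast
  have "y * k + (y * k) ^ Q = z * k"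
    using k(1) by (simp add: F z_def power_mult_distrib distrib_right)
  with k(2) have "Tr (y * k) = 1"
    unfolding trace_eq_relative by simp
  moreover have "x - x' \<in> F" "x + x' \<in> F" if "x \<in> F" "x' \<in> F" for x x'
  proof -
    show "x - x' \<in> F"
      using that unfolding F_def by (rule subfield_diff)
    show "x + x' \<in> F"
      using that by (simp only: F Q_power_add)
  qed
  ultimately have "2 * card {k \<in> F. Tr (y * k) = 1} = card F"
    using k(1) by (intro card_nonzero_functional[of F _ k]) (simp_all add: distrib_left trace_add)
  moreover have "{k \<in> F. Tr (y * k) = 1} = {k \<in> K. Tr (y * k) = 1}"
    by (auto simp: F_def)
  ultimately show ?thesis
    using False \<open>card F = Q\<close> by simp
qed

text \<open>Unions of cosets of \<open>K\<close> in the multiplicative group. Excluding 0 removes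
  the one orbit whose size is not \<open>Q - 1\<close>.\<close>

definition K_stable :: "'a set \<Rightarrow> bool"
  where "K_stable X \<longleftrightarrow> 0 \<notin> X \<and> (\<forall>x\<in>X. \<forall>k\<in>K. x * k \<in> X)"

lemma K_stable_mult_iff: "K_stable X \<Longrightarrow> k \<in> K \<Longrightarrow> x * k \<in> X \<longleftrightarrow> x \<in> X"
proof
  assume X: "K_stable X" "k \<in> K" "x * k \<in> X"
  then have "x * k * inverse k \<in> X"
    by (simp only: K_stable_def K_inverse)
  moreover have "x * k * inverse k = x"
    using X(2) by (simp add: mem_K_iff mult.assoc)
  ultimately show "x \<in> X" by simp
qed (simp add: K_stable_def)

lemma K_stable_0: "K_stable X \<Longrightarrow> 0 \<notin> X"
  by (simp add: K_stable_def)

lemma K_stable_Diff: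
  assumes "K_stable X" "K_stable Y"
  shows "K_stable (X - Y)"
  unfolding K_stable_def[of "X - Y"]
  by (simp add: K_stable_mult_iff[OF assms(1)] K_stable_mult_iff[OF assms(2)] K_stable_0[OF assms(1)])

text \<open>
  Average over the multiplications by \<^term>\<open>K\<close>: the trace form of a nonzero \<^term>\<open>y\<close> vanishes
  on \<^term>\<open>K\<close> if \<^term>\<open>y \<in> K\<close>, and is balanced on the subfield otherwise.
\<close>

lemma trace_weight_K_stable:
  assumes X: "K_stable X" and b: "b \<noteq> 0"
  shows "2 * (Q - 1) * card {x \<in> X. Tr (b * x) = 1} + (if inverse b \<in> X then Q * (Q - 1) else 0)
    = Q * card X"
proof -
  have X0: "x \<noteq> 0" if "x \<in> X" for x using that X by (auto simp: K_stable_def)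
  have "(\<Sum>x\<in>X. \<Sum>k\<in>K. of_bool (Tr (b * x * k) = 1) :: nat) = (\<Sum>k\<in>K. \<Sum>x\<in>X. of_bool (Tr (b * x * k) = 1))"
    by (rule sum.swap)
  then have "(\<Sum>x\<in>X. card {k \<in> K. Tr (b * x * k) = 1}) = (\<Sum>k\<in>K. card {x \<in> X. Tr (b * x * k) = 1})"
    by (simp add: Int_def)
  also have "\<dots> = (\<Sum>k\<in>K. card {x \<in> X. Tr (b * x) = 1})"
  proof (rule sum.cong[OF refl])
    fix k assume k: "k \<in> K"
    then have "k \<noteq> 0" by (simp add: mem_K_iff)
    have "bij_betw (\<lambda>x. x * k) {x \<in> X. Tr (b * x * k) = 1} {x \<in> X. Tr (b * x) = 1}"
      by (rule bij_betw_byWitness[where f' = "\<lambda>x. x * inverse k"])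
         (use K_stable_mult_iff[OF X] k K_inverse[OF k] \<open>k \<noteq> 0\<close> in \<open>auto simp: mult.assoc\<close>)
    then show "card {x \<in> X. Tr (b * x * k) = 1} = card {x \<in> X. Tr (b * x) = 1}"
      by (rule bij_betw_same_card)
  qed
  also have "\<dots> = (Q - 1) * card {x \<in> X. Tr (b * x) = 1}"
    by (simp add: card_K)
  finally have "2 * (Q - 1) * card {x \<in> X. Tr (b * x) = 1} = (\<Sum>x\<in>X. 2 * card {k \<in> K. Tr (b * x * k) = 1})"
    by (simp flip: sum_distrib_left)
  also have "\<dots> = (\<Sum>x\<in>X. if b * x \<in> K then 0 else Q)"
  proof (rule sum.cong[OF refl])
    fix x assume "x \<in> X"
    then have "b * x \<noteq> 0" using b X0 by simp
    then show "2 * card {k \<in> K. Tr (b * x * k) = 1} = (if b * x \<in> K then 0 else Q)"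
      by (simp only: card_trace_K mem_K_iff[of "b * x"] simp_thms)
  qed
  also have "\<dots> + (\<Sum>x\<in>X. if b * x \<in> K then Q else 0) = (\<Sum>x\<in>X. Q)"
    by (subst sum.distrib[symmetric]) (rule sum.cong, auto)
  finally have *: "2 * (Q - 1) * card {x \<in> X. Tr (b * x) = 1} + Q * card {x \<in> X. b * x \<in> K} = Q * card X"
    by (simp add: sum.If_cases Int_def mult.commute)
  \<comment> \<open>This is the part of \<open>X\<close> in the coset of \<open>inverse b\<close>,
    which by stability is the whole coset or empty.\<close>
  have "card {x \<in> X. b * x \<in> K} = (if inverse b \<in> X then Q - 1 else 0)"
  proof (cases "inverse b \<in> X")
    case True
    have "bij_betw (\<lambda>x. b * x) {x \<in> X. b * x \<in> K} K"
      by (rule bij_betw_byWitness[where f' = "\<lambda>k. inverse b * k"])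
         (use b True K_stable_mult_iff[OF X] in \<open>auto simp flip: mult.assoc\<close>)
    then show ?thesis
      using True by (simp add: bij_betw_same_card card_K)
  next
    case False
    have "b * x \<notin> K" if "x \<in> X" for x
    proof
      assume "b * x \<in> K"
      moreover have "inverse b * (b * x) = x" using b by simp
      ultimately show False
        using K_stable_mult_iff[OF X, of "b * x" "inverse b"] that False by metis
    qed
    then have "{x \<in> X. b * x \<in> K} = {}" by blast
    then show ?thesis unfolding \<open>{x \<in> X. b * x \<in> K} = {}\<close> using False by simp
  qed
  with * show ?thesis by (simp split: if_splits)
qed

text \<open>Instead of choosing coset representatives, the weight identity at \<open>b = 1\<close>
  shows that \<open>Q - 1\<close> divides \<open>Q * card X\<close>, and \<open>Q\<close> is coprime
  to \<open>Q - 1\<close>.\<close>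

lemma K_stable_dvd_card:
  assumes "K_stable X"
  shows "Q - 1 dvd card X"
proof -
  have "Q - 1 dvd 2 * (Q - 1) * card {x \<in> X. Tr (1 * x) = 1} + (if inverse 1 \<in> X then Q * (Q - 1) else 0)"
    by (intro dvd_add) auto
  then have "Q - 1 dvd Q * card X"
    by (subst (asm) trace_weight_K_stable[OF assms]) simp_all
  moreover have "coprime (Q - 1) Q"
    using Q_ge coprime_diff_one_left_nat[of Q] by simp
  ultimately show ?thesis by (simp add: coprime_dvd_mult_right_iff)
qed

text \<open>The quotient \<open>card X / (Q - 1)\<close> is the number of cosets of \<open>K\<close>
  in \<open>X\<close>. Each contributes \<open>Q / 2\<close>, except that the coset of
  \<open>inverse b\<close> contributes 0.\<close>

lemma trace_weight:
  assumes X: "K_stable X" and b: "b \<noteq> 0"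
  shows "real (card {x \<in> X. Tr (b * x) = 1})
    = real Q / 2 * (real (card X) / (real Q - 1) - of_bool (inverse b \<in> X))"
proof -
  define q where "q = real Q"
  define c where "c = real (card {x \<in> X. Tr (b * x) = 1})"
  have q: "q - 1 > 0" "real (Q - 1) = q - 1"
    using Q_ge by (simp_all add: q_def of_nat_diff)
  have "real (2 * (Q - 1) * card {x \<in> X. Tr (b * x) = 1} + (if inverse b \<in> X then Q * (Q - 1) else 0))
    = real (Q * card X)"
    by (simp only: trace_weight_K_stable[OF X b])
  then have "2 * (q - 1) * c + (if inverse b \<in> X then q * (q - 1) else 0) = q * real (card X)"
    by (simp only: of_nat_add of_nat_mult q(2) q_def[symmetric] c_def[symmetric] of_nat_numeral
        if_distrib[of real] of_nat_0)
  then have "c = q / 2 * (real (card X) / (q - 1) - of_bool (inverse b \<in> X))"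
    using q(1) by (cases "inverse b \<in> X") (simp_all add: field_simps)
  then show ?thesis
    by (simp only: c_def q_def)
qed

section \<open>Words twisted by a stable set, and their weights\<close>

definition code_word :: "'a set \<Rightarrow> 'a set \<Rightarrow> 'a \<Rightarrow> 'a \<Rightarrow> bit"
  where "code_word D Y b = (\<lambda>x. if x \<in> D then of_bool (x \<in> Y) + Tr (b * x) else 0)"

lemma code_word_add:
  "code_word D Y b + code_word D Z c = code_word D ((Y - Z) \<union> (Z - Y)) (b + c)"
  by (auto simp: code_word_def fun_eq_iff distrib_right trace_add)

lemma weight_code_word_0:
  assumes "Y \<subseteq> D"
  shows "hamming_weight D (code_word D Y 0) = card Y"
  unfolding hamming_weight_def using assms
  by (intro arg_cong[where f = card]) (auto simp: code_word_def of_bool_def)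

text \<open>On \<open>Y\<close> the word is the complement of \<open>Tr (b * x)\<close>, so a coset
  there has weight \<open>(Q - 1) - Q / 2\<close>, against \<open>Q / 2\<close> outside. The coset
  of \<open>inverse b\<close> is exceptional: it has weight \<open>Q - 1\<close> in \<open>Y\<close>
  and 0 in \<open>D - Y\<close>.\<close>

lemma weight_code_word:
  assumes D: "K_stable D" "Y \<subseteq> D" "K_stable Y" and b: "b \<noteq> 0"
  shows "real (hamming_weight D (code_word D Y b)) = real Q / 2 * (real (card (D - Y)) / (real Q - 1))
      + (real Q - 2) / 2 * (real (card Y) / (real Q - 1))
      + real Q / 2 * (of_bool (inverse b \<in> Y) - of_bool (inverse b \<in> D - Y))"
proof -
  have "{x \<in> D. code_word D Y b x \<noteq> 0} = {x \<in> D - Y. Tr (b * x) = 1} \<union> {x \<in> Y. Tr (b * x) = 0}"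
    using D(2) by (auto simp: code_word_def split: if_splits)
  then have "hamming_weight D (code_word D Y b)
      = card {x \<in> D - Y. Tr (b * x) = 1} + card {x \<in> Y. Tr (b * x) = 0}"
    unfolding hamming_weight_def by (simp only:) (rule card_Un_disjoint, auto)
  moreover have "card Y = card {x \<in> Y. Tr (b * x) = 0} + card {x \<in> Y. Tr (b * x) = 1}"
    by (subst card_Un_disjoint[symmetric]) (auto intro!: arg_cong[where f = card])
  ultimately have "real (hamming_weight D (code_word D Y b))
      = real (card {x \<in> D - Y. Tr (b * x) = 1}) + real (card Y) - real (card {x \<in> Y. Tr (b * x) = 1})"
    by simp
  then have "real (hamming_weight D (code_word D Y b))
      = real Q / 2 * (real (card (D - Y)) / (real Q - 1) - of_bool (inverse b \<in> D - Y)) + real (card Y)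
        - real Q / 2 * (real (card Y) / (real Q - 1) - of_bool (inverse b \<in> Y))"
    by (simp only: trace_weight[OF D(3) b] trace_weight[OF K_stable_Diff[OF D(1,3)] b])
  moreover have "real (card Y) = (real Q - 1) * (real (card Y) / (real Q - 1))"
    using Q_ge by simp
  moreover have "q / 2 * (r - i) + n - q / 2 * (s - j) = q / 2 * r + (q - 2) / 2 * s + q / 2 * (j - i)"
    if "n = (q - 1) * s" for q r s i j n :: real
    unfolding that by (simp add: field_simps)
  ultimately show ?thesis by metis
qed

end

section \<open>Trace codes twisted by stable sets\<close>

lemma of_nat_bit_eq_0_iff: "(of_nat n :: bit) = 0 \<longleftrightarrow> even n"
  by (induction n) (auto simp: bit_add_eq_0_iff)

text \<open>
  The code words are \<open>x \<mapsto> [x \<in> Y] + Tr (b x)\<close> on \<open>D\<close>. In the application \<open>[x \<in> Y]\<close> is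
  \<open>Tr (a x\<^sup>d)\<close>, which takes few values because \<open>x\<^sup>d\<close> is a cube root of unity.
\<close>

locale coset_code = quadratic_binary_field m field_type \<gamma> h
  for m :: nat and field_type :: "'a::finite_field itself" and \<gamma> :: 'a and h :: nat +
  fixes D :: "'a set" and \<Y> :: "'a set set"
  assumes D_stable: "K_stable D" and card_D: "Q - 1 < card D"
    and \<Y>_stable: "Y \<in> \<Y> \<Longrightarrow> K_stable Y" and \<Y>_subset: "Y \<in> \<Y> \<Longrightarrow> Y \<subseteq> D"
    and empty_in_\<Y>: "{} \<in> \<Y>"
    and \<Y>_sym_diff: "Y \<in> \<Y> \<Longrightarrow> Z \<in> \<Y> \<Longrightarrow> (Y - Z) \<union> (Z - Y) \<in> \<Y>"
begin

definition code :: "('a \<Rightarrow> bit) set"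
  where "code = (\<lambda>(Y, b). code_word D Y b) ` (\<Y> \<times> UNIV)"

text \<open>The weight for nonzero \<open>b\<close> with \<open>inverse b\<close> outside
  \<open>D\<close>, where no exceptional coset occurs.\<close>

definition base_weight :: "'a set \<Rightarrow> real"
  where "base_weight Y = real Q / 2 * (real (card (D - Y)) / (real Q - 1))
    + (real Q - 2) / 2 * (real (card Y) / (real Q - 1))"

lemma weight_inverse:
  assumes "Y \<in> \<Y>" "c \<noteq> 0"
  shows "real (hamming_weight D (code_word D Y (inverse c)))
    = base_weight Y + real Q / 2 * (of_bool (c \<in> Y) - of_bool (c \<in> D - Y))"
  using weight_code_word[OF D_stable \<Y>_subset[OF assms(1)] \<Y>_stable[OF assms(1)], of "inverse c"] assms(2)
  by (simp only: base_weight_def inverse_inverse_eq nonzero_imp_inverse_nonzero simp_thms)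

text \<open>With \<open>y\<close> cosets in \<open>Y\<close> and \<open>z\<close> outside, the only
  possible loss is one coset of weight \<open>q / 2\<close> in \<open>D - Y\<close>. Since
  \<open>D\<close> has at least two cosets, another one remains and has positive weight.\<close>

lemma weight_pos:
  assumes Y: "Y \<in> \<Y>" and b: "b \<noteq> 0"
  shows "hamming_weight D (code_word D Y b) > 0"
proof -
  define q where "q = real Q"
  have q: "q \<ge> 4" using Q_ge by (simp add: q_def)
  have stable: "K_stable Y" "K_stable (D - Y)" "Y \<subseteq> D"
    using D_stable \<Y>_stable[OF Y] \<Y>_subset[OF Y] K_stable_Diff by auto
  obtain y where y: "card Y = (Q - 1) * y"
    using K_stable_dvd_card[OF stable(1)] by (elim dvdE)
  obtain z where z: "card (D - Y) = (Q - 1) * z"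
    using K_stable_dvd_card[OF stable(2)] by (elim dvdE)
  have "card D = (Q - 1) * (y + z)"
    using y z card_Diff_subset[OF _ stable(3)] card_mono[OF _ stable(3)]
    by (simp add: distrib_left)
  with card_D have "(Q - 1) * 1 < (Q - 1) * (y + z)" by simp
  then have yz: "y + z \<ge> 2" by (metis Suc_1 Suc_leI mult_less_cancel1)
  have Q1: "real (Q - 1) = q - 1" using Q_ge by (simp add: q_def of_nat_diff)
  have base: "base_weight Y = q / 2 * z + (q - 2) / 2 * y"
    using q by (simp add: base_weight_def y z Q1 of_nat_diff del: One_nat_def flip: q_def)
  show ?thesis
  proof (cases "inverse b \<in> D - Y")
    case True
    \<comment> \<open>The coset of \<open>inverse b\<close> lies in \<open>D - Y\<close>, so
      \<open>z - 1\<close> is not negative and its factor \<open>q - 2\<close> may be raised to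
      \<open>q\<close>.\<close>
    then have "card (D - Y) \<noteq> 0" unfolding card_eq_0_iff by auto
    then have "z \<noteq> 0" unfolding z by auto
    have "0 < (q - 2) * 1" using q by simp
    also have "\<dots> \<le> (q - 2) * (real y + (real z - 1))"
      using yz q by (intro mult_left_mono) auto
    also have "\<dots> \<le> (q - 2) * real y + q * (real z - 1)"
      unfolding distrib_left using \<open>z \<noteq> 0\<close> by (intro add_left_mono mult_right_mono) auto
    also have "\<dots> = 2 * (q / 2 * z + (q - 2) / 2 * y - q / 2)"
      by (simp add: field_simps)
    finally have "0 < q / 2 * z + (q - 2) / 2 * y - q / 2" by simp
    then show ?thesis
      using True weight_inverse[OF Y, of "inverse b"] b by (simp add: base flip: q_def)
  next
    case False
    have "0 < (q - 2) * 2" using q by simp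
    also have "\<dots> \<le> (q - 2) * (real y + real z)"
      using yz q by (intro mult_left_mono) auto
    also have "\<dots> \<le> (q - 2) * real y + q * real z"
      unfolding distrib_left by (intro add_left_mono mult_right_mono) auto
    also have "\<dots> = 2 * (q / 2 * z + (q - 2) / 2 * y)"
      by (simp add: field_simps)
    finally have "0 < q / 2 * z + (q - 2) / 2 * y" by simp
    moreover have "0 \<le> q / 2 * of_bool (inverse b \<in> Y)" using q by simp
    ultimately have "0 < real (hamming_weight D (code_word D Y (inverse (inverse b))))"
      using False weight_inverse[OF Y, of "inverse b"] b
      by (cases "inverse b \<in> D"; cases "inverse b \<in> Y") (simp_all add: base flip: q_def)
    then show ?thesis by simp
  qed
qed

lemma code_word_eq_0:
  assumes "Y \<in> \<Y>" "code_word D Y b = 0"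
  shows "Y = {}" "b = 0"
proof -
  have "hamming_weight D (code_word D Y b) = 0"
    using assms(2) by (simp add: hamming_weight_def)
  then show "b = 0"
    using weight_pos[OF assms(1)] by force
  then show "Y = {}"
    using weight_code_word_0[OF \<Y>_subset[OF assms(1)]] \<open>hamming_weight D _ = 0\<close> by simp
qed

text \<open>The parametrisation is additive, with symmetric difference on the sets, and has trivial
  kernel. Counting words thus becomes counting pairs.\<close>

lemma inj_on_code_word: "inj_on (\<lambda>(Y, b). code_word D Y b) (\<Y> \<times> UNIV)"
proof (rule inj_onI, clarify)
  fix Y b Z c assume YZ: "Y \<in> \<Y>" "Z \<in> \<Y>" and "code_word D Y b = code_word D Z c"
  then have "code_word D ((Y - Z) \<union> (Z - Y)) (b + c) = 0"
    by (simp add: word_add_self flip: code_word_add)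
  note code_word_eq_0[OF \<Y>_sym_diff[OF YZ] this]
  then show "Y = Z \<and> b = c" by (auto simp: add_eq_0_iff_eq)
qed

lemma code_subset_words: "code \<subseteq> words D"
  by (auto simp: code_def code_word_def words_def)

lemma subspace_code: "word.subspace code"
proof (rule word_subspaceI)
  have "code_word D {} 0 = 0" by (simp add: code_word_def fun_eq_iff)
  then show "0 \<in> code"
    using empty_in_\<Y> unfolding code_def by (intro image_eqI[of _ _ "({}, 0)"]) auto
next
  fix u v assume "u \<in> code" "v \<in> code"
  then obtain Y b Z c where "Y \<in> \<Y>" "Z \<in> \<Y>" "u = code_word D Y b" "v = code_word D Z c"
    by (auto simp: code_def)
  then show "u + v \<in> code"
    using \<Y>_sym_diff by (auto simp: code_def code_word_add)
qed

lemma card_code: "card code = card \<Y> * 2 ^ m"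
  unfolding code_def by (simp only: card_image[OF inj_on_code_word] card_cartesian_product card_field)

text \<open>For each \<open>Y\<close>, the summands stand for \<open>b = 0\<close> and for
  \<open>inverse b\<close> in \<open>D - Y\<close>, in \<open>Y\<close>, or outside
  \<open>D\<close>. Indicators of \<open>w\<close> let coinciding weights add up without case
  distinctions.\<close>

lemma card_code_weight:
  "real (card {c \<in> code. real (hamming_weight D c) = w}) =
    (\<Sum>Y\<in>\<Y>. of_bool (real (card Y) = w)
      + real (card (D - Y)) * of_bool (base_weight Y - real Q / 2 = w)
      + real (card Y) * of_bool (base_weight Y + real Q / 2 = w)
      + (2 ^ m - 1 - real (card D)) * of_bool (base_weight Y = w))"
proof -
  define wt where "wt Y b = real (hamming_weight D (code_word D Y b))" for Y b
  have "{c \<in> code. real (hamming_weight D c) = w}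
      = (\<lambda>(Y, b). code_word D Y b) ` {p \<in> \<Y> \<times> UNIV. wt (fst p) (snd p) = w}"
    by (auto simp: code_def wt_def)
  moreover have "inj_on (\<lambda>(Y, b). code_word D Y b) {p \<in> \<Y> \<times> UNIV. wt (fst p) (snd p) = w}"
    by (rule inj_on_subset[OF inj_on_code_word]) auto
  ultimately have "real (card {c \<in> code. real (hamming_weight D c) = w})
      = real (card {p \<in> \<Y> \<times> UNIV. wt (fst p) (snd p) = w})"
    by (simp add: card_image)
  also have "\<dots> = (\<Sum>p\<in>\<Y> \<times> UNIV. of_bool (wt (fst p) (snd p) = w))"
    by (simp add: Int_def)
  also have "\<dots> = (\<Sum>Y\<in>\<Y>. \<Sum>b\<in>UNIV. of_bool (wt Y b = w))"
    by (simp only: sum.cartesian_product split_def)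
  also have "\<dots> = (\<Sum>Y\<in>\<Y>. of_bool (real (card Y) = w)
      + real (card (D - Y)) * of_bool (base_weight Y - real Q / 2 = w)
      + real (card Y) * of_bool (base_weight Y + real Q / 2 = w)
      + (2 ^ m - 1 - real (card D)) * of_bool (base_weight Y = w))"
  proof (rule sum.cong[OF refl])
    fix Y assume Y: "Y \<in> \<Y>"
    let ?g = "\<lambda>c. of_bool (wt Y (inverse c) = w) :: real"
    have "0 \<notin> D" "Y \<subseteq> D" using K_stable_0[OF D_stable] \<Y>_subset[OF Y] by auto
    have wt: "wt Y (inverse c) = base_weight Y + real Q / 2 * (of_bool (c \<in> Y) - of_bool (c \<in> D - Y))"
      if "c \<noteq> 0" for c
      using weight_inverse[OF Y that] by (simp only: wt_def)
    have "(\<Sum>b\<in>UNIV. of_bool (wt Y b = w) :: real)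
        = of_bool (wt Y 0 = w) + (\<Sum>b\<in>UNIV - {0}. of_bool (wt Y b = w))"
      by (rule sum.remove) simp_all
    also have "(\<Sum>b\<in>UNIV - {0}. of_bool (wt Y b = w)) = (\<Sum>c\<in>UNIV - {0}. ?g c)"
      by (rule sum.reindex_bij_witness[of _ inverse inverse]) auto
    also have "UNIV - {0} = (D - Y) \<union> Y \<union> (UNIV - {0} - D)"
      using \<open>0 \<notin> D\<close> \<open>Y \<subseteq> D\<close> by auto
    also have "sum ?g \<dots> = sum ?g (D - Y) + sum ?g Y + sum ?g (UNIV - {0} - D)"
      using \<open>Y \<subseteq> D\<close> by (subst sum.union_disjoint, simp, simp, blast, subst sum.union_disjoint) auto
    also have "sum ?g (D - Y) = real (card (D - Y)) * of_bool (base_weight Y - real Q / 2 = w)"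
    proof -
      have "sum ?g (D - Y) = (\<Sum>c\<in>D - Y. of_bool (base_weight Y - real Q / 2 = w))"
        using \<open>0 \<notin> D\<close> by (intro sum.cong refl) (subst wt, auto)
      then show ?thesis by simp
    qed
    also have "sum ?g Y = real (card Y) * of_bool (base_weight Y + real Q / 2 = w)"
    proof -
      have "sum ?g Y = (\<Sum>c\<in>Y. of_bool (base_weight Y + real Q / 2 = w))"
        using \<open>0 \<notin> D\<close> \<open>Y \<subseteq> D\<close> by (intro sum.cong refl) (subst wt, auto)
      then show ?thesis by simp
    qed
    also have "sum ?g (UNIV - {0} - D) = (2 ^ m - 1 - real (card D)) * of_bool (base_weight Y = w)"
    proof -
      have "sum ?g (UNIV - {0} - D) = (\<Sum>c\<in>UNIV - {0} - D. of_bool (base_weight Y = w))"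
        using \<open>Y \<subseteq> D\<close> by (intro sum.cong refl) (subst wt, auto)
      moreover have "card (insert 0 D \<union> (UNIV - {0} - D)) = card (insert 0 D) + card (UNIV - {0} - D)"
        by (rule card_Un_disjoint) auto
      moreover have "insert 0 D \<union> (UNIV - {0} - D) = UNIV" by auto
      ultimately have "2 ^ m = card (insert 0 D) + card (UNIV - {0} - D)"
        and "sum ?g (UNIV - {0} - D) = real (card (UNIV - {0} - D)) * of_bool (base_weight Y = w)"
        by (simp_all only: card_field sum_constant)
      moreover from this(1) have "2 ^ m = 1 + card D + card (UNIV - {0} - D)"
        using \<open>0 \<notin> D\<close> by simp
      then have "2 ^ m = 1 + real (card D) + real (card (UNIV - {0} - D))"
        by (metis of_nat_1 of_nat_add of_nat_numeral of_nat_power)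
      ultimately show ?thesis by simp
    qed
    finally show "(\<Sum>b\<in>UNIV. of_bool (wt Y b = w) :: real) = of_bool (real (card Y) = w)
      + real (card (D - Y)) * of_bool (base_weight Y - real Q / 2 = w)
      + real (card Y) * of_bool (base_weight Y + real Q / 2 = w)
      + (2 ^ m - 1 - real (card D)) * of_bool (base_weight Y = w)"
      using weight_code_word_0[OF \<open>Y \<subseteq> D\<close>] by (simp add: wt_def)
  qed
  finally show ?thesis .
qed

text \<open>With \<open>S\<close> the support of \<open>u\<close>, the pairing with the word of
  \<open>Y\<close> and \<open>b\<close> is the parity of \<open>S \<inter> Y\<close> plus the trace
  of \<open>b\<close> times the sum of \<open>S\<close>. Taking \<open>Y = {}\<close> and all
  \<open>b\<close>, nondegeneracy makes the sum vanish; only the parities remain.\<close>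

lemma dual_code_iff:
  assumes u: "u \<in> words D"
  shows "u \<in> dual_code D code \<longleftrightarrow>
    (\<Sum>x | x \<in> D \<and> u x = 1. x) = 0 \<and> (\<forall>Y\<in>\<Y>. even (card {x \<in> Y. u x = 1}))"
proof -
  define S where "S = {x \<in> D. u x = 1}"
  have S_Y: "{x \<in> Y. u x = 1} = S \<inter> Y" if "Y \<in> \<Y>" for Y
    using \<Y>_subset[OF that] by (auto simp: S_def)
  have ip: "(\<Sum>x\<in>D. u x * code_word D Y b x) = of_nat (card (S \<inter> Y)) + Tr (b * \<Sum>S)" for Y b
  proof -
    have "(\<Sum>x\<in>D. u x * code_word D Y b x) = (\<Sum>x\<in>D. if u x = 1 then of_bool (x \<in> Y) + Tr (b * x) else 0)"
      by (rule sum.cong) (auto simp: code_word_def)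
    also have "\<dots> = (\<Sum>x\<in>S. of_bool (x \<in> Y) + Tr (b * x))"
      by (simp add: S_def sum.inter_filter)
    also have "\<dots> = of_nat (card (S \<inter> Y)) + Tr (b * \<Sum>S)"
      by (simp add: sum.distrib sum_distrib_left trace_sum)
    finally show ?thesis .
  qed
  have "u \<in> dual_code D code \<longleftrightarrow> (\<forall>Y\<in>\<Y>. \<forall>b. of_nat (card (S \<inter> Y)) + Tr (b * \<Sum>S) = 0)"
    using u by (simp add: dual_code_def code_def ip)
  also have "\<dots> \<longleftrightarrow> \<Sum>S = 0 \<and> (\<forall>Y\<in>\<Y>. even (card (S \<inter> Y)))"
  proof
    assume *: "\<forall>Y\<in>\<Y>. \<forall>b. of_nat (card (S \<inter> Y)) + Tr (b * \<Sum>S) = 0"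
    have "\<Sum>S = 0"
    proof (rule ccontr)
      assume "\<Sum>S \<noteq> 0"
      then obtain b where "Tr (b * \<Sum>S) = 1" by (rule trace_nondegenerate)
      with * empty_in_\<Y> show False by force
    qed
    with * show "\<Sum>S = 0 \<and> (\<forall>Y\<in>\<Y>. even (card (S \<inter> Y)))"
      by (auto simp: of_nat_bit_eq_0_iff)
  qed (auto simp: of_nat_bit_eq_0_iff)
  finally show ?thesis
    using S_Y by (simp add: S_def)
qed

lemma hamming_weight_eq: "hamming_weight D u = card {x \<in> D. u x = 1}"
  by (simp add: hamming_weight_def)

text \<open>The support sums to 0. One element would have to be 0, which is not in \<open>D\<close>;
  two would have to be equal, in characteristic 2.\<close>

lemma dual_weight_ge_3:
  assumes u: "u \<in> dual_code D code" "u \<noteq> 0"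
  shows "hamming_weight D u \<ge> 3"
proof -
  define S where "S = {x \<in> D. u x = 1}"
  have words: "u \<in> words D" using u(1) dual_code_subset by blast
  then have sum: "\<Sum>S = 0"
    using u(1) by (simp add: dual_code_iff S_def)
  obtain x where "u x \<noteq> 0" using u(2) by (auto simp: fun_eq_iff)
  then have "x \<in> S" using words by (auto simp: S_def words_def)
  then have "card S \<noteq> 0" by auto
  moreover have "card S \<noteq> 1"
  proof
    assume "card S = 1"
    with \<open>x \<in> S\<close> have "S = {x}" by (metis card_1_singletonE singletonD)
    with sum have "x = 0" by simp
    with \<open>x \<in> S\<close> show False using K_stable_0[OF D_stable] by (simp add: S_def)
  qed
  moreover have "card S \<noteq> 2"
  proof
    assume "card S = 2"
    then obtain y z where "S = {y, z}" "y \<noteq> z" by (metis card_2_iff)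
    with sum show False by (simp add: add_eq_0_iff_eq)
  qed
  ultimately have "card S \<ge> 3" by linarith
  then show ?thesis by (simp add: hamming_weight_eq S_def)
qed

lemma binary_code_code:
  assumes "card \<Y> = 2 ^ k"
  shows "binary_code D (card D) (m + k) code"
    and "binary_code D (card D) (card D - (m + k)) (dual_code D code)"
  using assms code_subset_words subspace_code card_code
  by (auto intro!: binary_codeI binary_code_dual simp: power_add mult.commute)

end

section \<open>The code on a cyclic subgroup\<close>

text \<open>The sphere packing bound in contrapositive form, for a code of redundancy
  \<open>j\<close>. It yields both the dual word of weight 4 and the optimality.\<close>

lemma exists_close_words:
  assumes I: "finite I" and C: "C \<subseteq> words I" and card: "card C * 2 ^ j = 2 ^ card I"
    and large: "2 ^ j < (\<Sum>i\<le>e. card I choose i)"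
  shows "\<exists>u\<in>C. \<exists>v\<in>C. u \<noteq> v \<and> hamming_dist I u v \<le> 2 * e"
proof (rule ccontr)
  assume "\<not> ?thesis"
  then have "2 * e < hamming_dist I u v" if "u \<in> C" "v \<in> C" "u \<noteq> v" for u v
    using that by force
  then have "card C * (\<Sum>i\<le>e. card I choose i) \<le> card C * 2 ^ j"
    unfolding card by (rule sphere_packing_bound[OF I C])
  moreover have "card C > 0"
    using card by (intro Nat.gr0I) auto
  ultimately show False using large by simp
qed

section \<open>Power maps on cosets of \<open>K\<close>, and bases over the subfield\<close>

context quadratic_binary_field
begin

lemma K_power:
  assumes "k \<in> K" "Q - 1 dvd n"
  shows "k ^ n = 1"
proof -
  obtain r where "n = (Q - 1) * r" using assms(2) by (elim dvdE)
  then show ?thesis using assms(1) by (simp add: K_def power_mult)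
qed

lemma K_stable_fibre:
  assumes "K_stable A" "Q - 1 dvd n"
  shows "K_stable {x \<in> A. P (x ^ n)}"
  using assms K_power[OF _ assms(2)] by (simp add: K_stable_def power_mult_distrib)

lemma K_stable_roots:
  assumes "Q - 1 dvd n" "n > 0"
  shows "K_stable {x. x ^ n = 1}"
  using K_power[OF _ assms(1)] assms(2) by (simp add: K_stable_def power_mult_distrib zero_power)

text \<open>The ratio condition makes \<open>e\<close> and \<open>e'\<close> independent over the
  subfield, so their \<open>Q * Q\<close> combinations are distinct and exhaust the field.\<close>

lemma subfield_combination:
  assumes e: "e \<noteq> 0" "e' \<noteq> 0" "e / e' \<notin> K"
  obtains a b where "a \<in> insert 0 K" "b \<in> insert 0 K" "z = a * e + b * e'"
proof -
  define F where "F = insert 0 K"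
  have "inj_on (\<lambda>(a, b). a * e + b * e') (F \<times> F)"
  proof (rule inj_onI, clarify)
    fix a b a' b' assume F: "a \<in> F" "b \<in> F" "a' \<in> F" "b' \<in> F"
      and "a * e + b * e' = a' * e + b' * e'"
    then have eq: "(a - a') * e = (b' - b) * e'"
      by (simp add: algebra_simps)
    have "a = a'"
    proof (rule ccontr)
      assume "a \<noteq> a'"
      then have "a - a' \<noteq> 0" "b' - b \<noteq> 0"
        using eq e by auto
      then have "a - a' \<in> K" "b' - b \<in> K"
        using subfield_diff[of a a'] subfield_diff[of b' b] F by (simp_all add: F_def)
      then have "(b' - b) * inverse (a - a') \<in> K"
        by (intro K_mult K_inverse)
      moreover have "e / e' = (b' - b) * inverse (a - a')"
        using eq e \<open>a \<noteq> a'\<close> by (simp add: field_simps)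
      ultimately show False using e by simp
    qed
    with eq e show "a = a' \<and> b = b'" by simp
  qed
  moreover have "card (F \<times> F) = CARD('a)"
    unfolding card_cartesian_product F_def card_subfield card_field
    by (simp only: Q_def m_eq mult_2 power_add)
  ultimately have "(\<lambda>(a, b). a * e + b * e') ` (F \<times> F) = UNIV"
    by (intro card_subset_eq) (simp_all add: card_image)
  then have "z \<in> (\<lambda>(a, b). a * e + b * e') ` (F \<times> F)"
    by (simp only: UNIV_I)
  then obtain p where p: "z = (\<lambda>(a, b). a * e + b * e') p" "p \<in> F \<times> F"
    by (rule imageE)
  then have "fst p \<in> F" "snd p \<in> F" "z = fst p * e + snd p * e'"
    by (auto simp: split_def)
  then show ?thesis
    unfolding F_def by (rule that)
qed

end

text \<open>Here \<open>s\<close> is the number of cosets of \<open>K\<close> in \<open>D\<close>,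
  and \<open>s \<ge> 2\<close> encodes \<open>t \<noteq> Q + 1\<close>.\<close>

locale subgroup_trace_code = quadratic_binary_field m field_type \<gamma> h
  for m :: nat and field_type :: "'a::finite_field itself" and \<gamma> :: 'a and h :: nat +
  fixes t s d :: nat
  assumes ts: "t * s = Q + 1" and s_ge: "s \<ge> 2" and d: "3 * d = 2 ^ m - 1" and three_dvd: "3 dvd Q + 1"
begin

abbreviation N :: nat where "N \<equiv> (Q - 1) * s"

definition D :: "'a set" where "D = {x. x ^ N = 1}"

definition Y :: "'a \<Rightarrow> 'a set" where "Y a = {x \<in> D. Tr (a * x ^ d) = 1}"

lemma N_t: "N * t = 2 ^ m - 1"
  using ts by (simp only: card_units mult.assoc mult.commute[of s])

lemma card_D_eq: "card D = N"
  unfolding D_def by (rule roots_of_unity_eq(2)[OF N_t])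

lemma D_eq: "D = cyclic_subgroup (\<gamma> ^ t)"
  unfolding D_def by (rule cyclic_subgroup_eq[OF N_t, symmetric])

lemma d_eq: "d = (Q - 1) * ((Q + 1) div 3)"
proof -
  have "3 * d = 3 * ((Q - 1) * ((Q + 1) div 3))"
    using three_dvd by (simp only: d card_units mult.left_commute[of 3] dvd_mult_div_cancel)
  then show ?thesis by simp
qed

lemma D_stable: "K_stable D"
  unfolding D_def using s_ge Q_ge by (intro K_stable_roots) simp_all

lemma Y_stable: "K_stable (Y a)"
  unfolding Y_def using d_eq by (intro K_stable_fibre[OF D_stable]) simp

sublocale coset_code m field_type \<gamma> h D "range Y"
proof
  show "K_stable D" by (rule D_stable)
  show "Q - 1 < card D" using Q_ge s_ge by (simp add: card_D_eq)
  show "{} \<in> range Y"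
    by (intro image_eqI[of _ _ 0]) (simp_all add: Y_def)
  fix X Z assume "X \<in> range Y" "Z \<in> range Y"
  then obtain a b where "X = Y a" "Z = Y b" by blast
  then have "(X - Z) \<union> (Z - X) = Y (a + b)"
    by (auto simp: Y_def distrib_right trace_add)
  then show "(X - Z) \<union> (Z - X) \<in> range Y" by blast
qed (use Y_stable in \<open>auto simp: Y_def\<close>)

lemma code_eq: "code = trace_code m (\<lambda>x. x ^ d) D"
proof -
  have "code = {code_word D (Y a) b | a b. True}"
    by (force simp: code_def)
  also have "code_word D (Y a) b = (\<lambda>x. if x \<in> D then Tr (a * x ^ d + b * x) else 0)" for a b
    by (auto simp: code_word_def fun_eq_iff Y_def trace_add)
  then have "{code_word D (Y a) b | a b. True} = trace_code m (\<lambda>x. x ^ d) D"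
    by (simp only: trace_code_def)
  finally show ?thesis .
qed

lemma two_power_m: "2 ^ m = Q * Q"
  by (simp only: Q_def m_eq mult_2 power_add)

lemma real_N: "real N = (real Q - 1) * real s"
  using Q_ge by (simp add: of_nat_diff)

lemma three_dvd_s: "\<not> 3 dvd t \<Longrightarrow> 3 dvd s"
proof -
  assume "\<not> 3 dvd t"
  moreover have "3 dvd t * s" using three_dvd ts by simp
  moreover have "prime (3 :: nat)" by simp
  ultimately show ?thesis using prime_dvd_mult_iff by blast
qed

lemma s_odd: "odd s"
proof -
  have "even Q" using h_ge by (simp add: Q_def)
  then have "odd (t * s)" by (simp add: ts)
  then show ?thesis by simp
qed

lemma base_weight_eq:
  assumes "card (D - X) = (Q - 1) * z" "card X = (Q - 1) * y"
  shows "base_weight X = real Q / 2 * real z + (real Q - 2) / 2 * real y"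
  using Q_ge by (simp add: base_weight_def assms of_nat_diff del: One_nat_def)

section \<open>The case \<open>3 dvd t\<close>, where x^d is trivial on \<open>D\<close>\<close>

context
  assumes t3: "3 dvd t"
begin

lemma D_power_d: "x \<in> D \<Longrightarrow> x ^ d = 1"
proof -
  assume "x \<in> D"
  obtain u where u: "t = 3 * u" using t3 by (elim dvdE)
  then have "3 * (u * s) = Q + 1" using ts by (simp only: mult.assoc)
  then have "(Q + 1) div 3 = u * s" by (metis nonzero_mult_div_cancel_left numeral_neq_zero)
  then have "d = N * u" by (simp only: d_eq mult.assoc mult.commute[of u])
  with \<open>x \<in> D\<close> show ?thesis by (simp add: D_def power_mult)
qed

lemma D_nonempty: "D \<noteq> {}"
  using card_D by force

text \<open>Only \<open>Tr a\<close> matters: the code consists of the words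
  \<open>Tr (b * x)\<close> and their complements on \<open>D\<close>.\<close>

lemma range_Y_3_dvd: "range Y = {{}, D}"
proof -
  have Y: "Y a = (if Tr a = 1 then D else {})" for a
    by (auto simp: Y_def D_power_d)
  obtain a where "Tr (a * 1) = 1" by (rule trace_nondegenerate[of 1]) simp_all
  then have "Y a = D" "Y 0 = {}" by (simp_all add: Y)
  then have "D \<in> range Y" "{} \<in> range Y" by (metis rangeI)+
  with Y show ?thesis by auto
qed

lemma card_range_Y_3_dvd: "card (range Y) = 2 ^ 1"
  using D_nonempty by (simp add: range_Y_3_dvd)

text \<open>The weights built on \<open>Q / 2 * s\<close> come from \<open>Y = {}\<close> and those
  built on \<open>(Q - 2) / 2 * s\<close> from \<open>Y = D\<close>. The rows 0 and \<open>N\<close>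
  are the two words with \<open>b = 0\<close>.\<close>

lemma weight_distribution_3_dvd:
  "has_weight_distribution D code
    [(0, 1),
     ((real Q - 2) / 2 * s, real Q * real Q - 1 - real N),
     (real Q / 2 * s, real Q * real Q - 1 - real N),
     ((real Q - 2) / 2 * s + real Q / 2, real N),
     (real Q / 2 * s - real Q / 2, real N),
     (real N, 1)]"
  (is "has_weight_distribution D code ?tab")
proof -
  have base: "base_weight {} = real Q / 2 * s" "base_weight D = (real Q - 2) / 2 * s"
    using base_weight_eq[of "{}" s 0] base_weight_eq[of D 0 s] by (simp_all add: card_D_eq)
  have Q2: "2 ^ m = real Q * real Q"
    using two_power_m by (metis of_nat_mult of_nat_numeral of_nat_power)
  show ?thesis
    unfolding has_weight_distribution_def
  proof
    fix w :: real
    define e where "e v = (of_bool (v = w) :: real)" for v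
    have if_eq: "(if v = w then \<mu> else 0) = \<mu> * e v" for v \<mu> :: real
      by (simp add: e_def)
    have "(\<Sum>X\<in>range Y. g X) = g {} + g D" for g :: "'a set \<Rightarrow> real"
      using D_nonempty by (simp add: range_Y_3_dvd)
    then show "real (card {c \<in> code. real (hamming_weight D c) = w})
      = (\<Sum>(v, \<mu>) \<leftarrow> ?tab. if v = w then \<mu> else 0)"
      by (simp only: card_code_weight e_def[symmetric] if_eq base card_D_eq Q2 list.map prod.case
          sum_list.Cons sum_list.Nil Diff_empty Diff_cancel card.empty of_nat_0 mult_zero_left add_0_right mult_1_left
          mult_1_right add_ac)
  qed
qed

text \<open>As \<open>s\<close> is odd, it is at least 3, so \<open>N \<ge> 3 * (Q - 1)\<close> and
  the quadratic term, about 9/2 of \<open>Q ^ 2\<close>, exceeds \<open>2 * Q ^ 2\<close>. For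
  \<open>s = 2\<close> the ball would have size \<open>2 * Q ^ 2 - 3 * Q + 2\<close>, just too
  small.\<close>

lemma large_ball: "2 ^ (m + 1) < (\<Sum>i\<le>2. N choose i)"
proof -
  have "s \<noteq> 2" using s_odd by auto
  then have "3 * (Q - 1) \<le> N" using s_ge by simp
  then obtain n where n: "N = n + 3 * (Q - 1)" by (metis le_add_diff_inverse2)
  obtain q where q: "Q = q + 4" using Q_ge by (metis le_add_diff_inverse2)
  have choose: "2 * (k choose 2) = k * (k - 1)" for k :: nat
    by (cases k) (simp_all add: choose_two)
  have "N = n + 3 * q + 9" using n q by simp
  then have "2 * (2 * (Q * Q)) < 2 + 2 * N + N * (N - 1)"
    by (simp add: q algebra_simps)
  also have "\<dots> = 2 * (\<Sum>i\<le>2. N choose i)"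
    using choose[of N] by (simp add: numeral_2_eq_2)
  finally show ?thesis by (simp add: two_power_m)
qed

text \<open>Since \<open>D\<close> itself is one of the sets \<open>Y a\<close>, the code contains
  the all-one word and dual words have even weight.\<close>

lemma dual_weight_ge_4:
  assumes u: "u \<in> dual_code D code" "u \<noteq> 0"
  shows "hamming_weight D u \<ge> 4"
proof -
  have "u \<in> words D" using u(1) dual_code_subset by blast
  then have "even (card {x \<in> D. u x = 1})"
    using u(1) dual_code_iff range_Y_3_dvd by auto
  then have "hamming_weight D u \<noteq> 3"
    unfolding hamming_weight_eq by (metis odd_numeral)
  with dual_weight_ge_3[OF u] show ?thesis by simp
qed

lemma min_distance_dual_4: "has_min_distance D (dual_code D code) 4"
proof -
  have "card (dual_code D code) * 2 ^ (m + 1) = 2 ^ card D"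
    using card_dual_code[OF _ code_subset_words subspace_code]
    by (simp add: card_code card_range_Y_3_dvd mult.commute)
  then obtain u v where uv: "u \<in> dual_code D code" "v \<in> dual_code D code" "u \<noteq> v"
    and "hamming_dist D u v \<le> 2 * 2"
    using exists_close_words[OF _ dual_code_subset, of D code "m + 1" 2] large_ball
    by (auto simp: card_D_eq)
  then have "hamming_weight D (u + v) \<le> 4" by (simp add: hamming_dist_eq_weight)
  moreover have w: "u + v \<in> dual_code D code" "u + v \<noteq> 0"
    using uv word.subspace_add[OF subspace_dual_code] by (simp_all add: word_add_eq_0_iff)
  ultimately have "hamming_weight D (u + v) = 4"
    using dual_weight_ge_4[OF w] by simp
  then show ?thesis
    using w dual_weight_ge_4 by (intro has_min_distanceI subspace_dual_code) auto
qed

lemma dual_distance_optimal: "distance_optimal D (dual_code D code)"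
  unfolding distance_optimal_def
proof (intro exI conjI notI)
  show "binary_code_dist D N (N - (m + 1)) 4 (dual_code D code)"
    using binary_code_code(2)[OF card_range_Y_3_dvd] min_distance_dual_4
    by (simp add: binary_code_dist_def card_D_eq)
next
  assume "\<exists>\<delta>' (C' :: (nat \<Rightarrow> bit) set). \<delta>' \<ge> 4 + 1 \<and> binary_code_dist {..<N} N (N - (m + 1)) \<delta>' C'"
  then obtain \<delta>' and C' :: "(nat \<Rightarrow> bit) set" where "\<delta>' \<ge> 5"
    and C': "C' \<subseteq> words {..<N}" "word.subspace C'" "word.dim C' = N - (m + 1)"
    and dist: "\<And>u v. u \<in> C' \<Longrightarrow> v \<in> C' \<Longrightarrow> u \<noteq> v \<Longrightarrow> \<delta>' \<le> hamming_dist {..<N} u v"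
    by (auto simp: binary_code_dist_def binary_code_def has_min_distance_def)
  have "card C' = 2 ^ (N - (m + 1))"
    using card_subspace_bit[OF C'(2)] finite_subset[OF C'(1)] C'(3) by (simp add: finite_words)
  \<comment> \<open>The exponent \<open>N - (m + 1)\<close> is a truncated subtraction, so
    \<open>m + 1 \<le> N\<close> is needed here.\<close>
  then have "card C' * 2 ^ (m + 1) = 2 ^ card {..<N}"
    using dim_le_length[OF _ code_subset_words subspace_code, of "m + 1"]
    by (simp add: card_code card_range_Y_3_dvd card_D_eq flip: power_add power_Suc)
  then obtain u v where "u \<in> C'" "v \<in> C'" "u \<noteq> v" "hamming_dist {..<N} u v \<le> 2 * 2"
    using exists_close_words[OF _ C'(1), of "m + 1" 2] large_ball by auto
  with dist[of u v] \<open>\<delta>' \<ge> 5\<close> show False by simp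
qed

end

section \<open>The case \<open>\<not> 3 dvd t\<close>: three cubic classes on \<open>D\<close>, each
  of \<open>r\<close> cosets of \<open>K\<close>\<close>

context
  fixes r :: nat
  assumes t3: "\<not> 3 dvd t" and s_eq: "s = 3 * r"
begin

lemma N_eq: "N = 3 * ((Q - 1) * r)"
  by (simp only: s_eq mult.left_commute)

definition \<omega> :: 'a where "\<omega> = \<gamma> ^ d"

definition M :: "'a set" where "M = {1, \<omega>, \<omega> ^ 2}"

lemma omega_cube: "\<omega> ^ 3 = 1"
  using nonzero_power[OF \<gamma>_nonzero] by (simp only: \<omega>_def d mult.commute[of d] flip: power_mult)

lemma omega_ne_1: "\<omega> \<noteq> 1"
proof
  assume "\<omega> = 1"
  then have "3 * d dvd d" by (simp only: \<omega>_def \<gamma>_power_eq_1_iff d)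
  moreover have "d > 0" using card_units_pos d by (intro Nat.gr0I) auto
  ultimately show False by (auto dest: dvd_imp_le)
qed

lemma omega_sum: "1 + \<omega> + \<omega> ^ 2 = 0"
proof -
  have "(\<omega> - 1) * (1 + \<omega> + \<omega> ^ 2) = \<omega> ^ 3 - 1"
    by (simp add: algebra_simps power2_eq_square power3_eq_cube)
  with omega_cube omega_ne_1 show ?thesis by simp
qed

lemma omega_nonzero: "\<omega> \<noteq> 0"
  using omega_cube by auto

lemma omega_distinct: "\<omega> ^ 2 \<noteq> 1" "\<omega> ^ 2 \<noteq> \<omega>"
proof -
  show "\<omega> ^ 2 \<noteq> \<omega>" using omega_nonzero omega_ne_1 by (simp add: power2_eq_square)
  show "\<omega> ^ 2 \<noteq> 1"
  proof
    assume "\<omega> ^ 2 = 1"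
    moreover have "\<omega> ^ 3 = \<omega> ^ 2 * \<omega>" by (simp add: power2_eq_square power3_eq_cube)
    ultimately show False using omega_cube omega_ne_1 by simp
  qed
qed

lemma card_M: "card M = 3"
  using omega_distinct omega_ne_1 by (simp add: M_def)

lemma M_eq: "M = {w. w ^ 3 = 1}"
proof (rule card_subset_eq)
  show "M \<subseteq> {w. w ^ 3 = 1}"
  proof -
    have "(\<omega> ^ 2) ^ 3 = (\<omega> ^ 3) ^ 2" by (simp only: mult.commute flip: power_mult)
    then show ?thesis using omega_cube by (simp add: M_def)
  qed
  show "card M = card {w :: 'a. w ^ 3 = 1}"
    using roots_of_unity_eq(2)[OF d] card_M by simp
qed simp

lemma M_closed: "v \<in> M \<Longrightarrow> w \<in> M \<Longrightarrow> v * w \<in> M" "w \<in> M \<Longrightarrow> inverse w \<in> M" "w \<in> M \<Longrightarrow> w \<noteq> 0"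
  by (auto simp: M_eq power_mult_distrib power_inverse)

lemma power_d_in_M: "x \<in> D \<Longrightarrow> x ^ d \<in> M"
proof -
  assume "x \<in> D"
  then have "x \<noteq> 0" using K_stable_0[OF D_stable] by auto
  then have "x ^ (d * 3) = 1"
    using nonzero_power by (simp only: d mult.commute[of d])
  then show ?thesis by (simp add: M_eq power_mult)
qed

definition fibre :: "'a \<Rightarrow> 'a set" where "fibre w = {x \<in> D. x ^ d = w}"

lemma exists_fibre: "w \<in> M \<Longrightarrow> \<exists>e. e \<in> fibre w"
proof -
  assume "w \<in> M"
  then obtain i where i: "w = \<omega> ^ i"
    unfolding M_def by (metis insertE power_0 power_one_right singletonD)
  have "t mod 3 = 1 \<or> t mod 3 = 2" using t3 by (auto simp: dvd_eq_mod_eq_0)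
  moreover have "(t * t) mod 3 = ((t mod 3) * (t mod 3)) mod 3"
    by (simp only: mod_mult_eq)
  ultimately have "(t * t) mod 3 = 1"
    by auto
  then obtain k where k: "t * t = 3 * k + 1"
    by (metis div_mult_mod_eq mult.commute)
  \<comment> \<open>The d-th power of \<open>\<gamma> ^ t\<close> is \<open>\<omega> ^ t\<close>,
    and \<open>t\<close> is its own inverse modulo 3; hence the second factor \<open>t\<close> in
    the exponent.\<close>
  define e where "e = (\<gamma> ^ t) ^ (t * i)"
  have "(\<gamma> ^ t) ^ N = 1"
    using nonzero_power[OF \<gamma>_nonzero] by (simp only: N_t mult.commute[of t] flip: power_mult)
  moreover have "e ^ N = ((\<gamma> ^ t) ^ N) ^ (t * i)"
    by (simp only: e_def mult_ac flip: power_mult)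
  ultimately have "e \<in> D" by (simp add: D_def)
  moreover have "e ^ d = (\<omega> ^ (t * t)) ^ i"
    by (simp only: e_def \<omega>_def mult_ac flip: power_mult)
  moreover have "\<omega> ^ (t * t) = \<omega>"
    by (simp add: k power_add power_mult omega_cube)
  ultimately show ?thesis
    by (auto simp: fibre_def i)
qed

lemma D_mult: "x \<in> D \<Longrightarrow> y \<in> D \<Longrightarrow> x * y \<in> D" "x \<in> D \<Longrightarrow> inverse x \<in> D"
  by (simp_all add: D_def power_mult_distrib power_inverse)

lemma D_nonzero: "x \<in> D \<Longrightarrow> x \<noteq> 0"
  using K_stable_0[OF D_stable] by auto

text \<open>Multiplication by an element of class \<open>v\<close> maps class 1 onto class
  \<open>v\<close>, so the three classes split \<open>D\<close> evenly.\<close>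

lemma card_fibre: "w \<in> M \<Longrightarrow> card (fibre w) = (Q - 1) * r"
proof -
  have eq: "card (fibre v) = card (fibre 1)" if v: "v \<in> M" for v
  proof -
    obtain e where e: "e \<in> D" "e ^ d = v" using exists_fibre[OF v] by (auto simp: fibre_def)
    have "bij_betw (\<lambda>x. e * x) (fibre 1) (fibre v)"
      by (rule bij_betw_byWitness[where f' = "\<lambda>x. inverse e * x"])
         (use e D_mult D_nonzero[OF e(1)] M_closed(3)[OF v] in
           \<open>auto simp: fibre_def power_mult_distrib power_inverse simp flip: mult.assoc\<close>)
    then show ?thesis by (simp add: bij_betw_same_card)
  qed
  have "D = (\<Union>w\<in>M. fibre w)"
    using power_d_in_M by (auto simp: fibre_def)
  then have "card D = card (\<Union>w\<in>M. fibre w)" by simp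
  also have "\<dots> = (\<Sum>w\<in>M. card (fibre w))"
    by (rule card_UN_disjoint) (auto simp: fibre_def)
  also have "\<dots> = (\<Sum>w\<in>M. card (fibre 1))"
    by (rule sum.cong[OF refl]) (rule eq)
  finally have "3 * card (fibre 1) = N"
    by (simp add: card_M card_D_eq)
  then have "card (fibre 1) = (Q - 1) * r"
    unfolding N_eq by simp
  moreover assume "w \<in> M"
  ultimately show ?thesis using eq by simp
qed

text \<open>The cube roots of unity sum to 0, so the three traces do too: none or exactly two of
  them are 1.\<close>

lemma trace_pattern:
  "(\<forall>v\<in>M. Tr (a * v) = 0) \<or> (\<exists>w\<in>M. \<forall>v\<in>M. Tr (a * v) = of_bool (v \<noteq> w))"
proof -
  have "Tr (a * 1) + Tr (a * \<omega>) + Tr (a * \<omega> ^ 2) = Tr (a * (1 + \<omega> + \<omega> ^ 2))"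
    by (simp only: distrib_left trace_add)
  then have sum: "Tr (a * 1) + Tr (a * \<omega>) + Tr (a * \<omega> ^ 2) = 0"
    by (simp only: omega_sum mult_zero_right trace_0)
  show ?thesis
    using sum omega_ne_1 omega_distinct unfolding M_def
    by (cases "Tr (a * 1)"; cases "Tr (a * \<omega>)"; cases "Tr (a * \<omega> ^ 2)") auto
qed

text \<open>Some \<open>a\<close> has a nonzero pattern with exception \<open>w\<close>; replacing
  \<open>a\<close> by \<open>a * (w * inverse u)\<close> rotates the exception to
  \<open>u\<close>.\<close>

lemma trace_pattern_attained:
  assumes "u \<in> M"
  obtains a where "\<And>v. v \<in> M \<Longrightarrow> Tr (a * v) = of_bool (v \<noteq> u)"
proof -
  obtain a where "Tr (a * 1) = 1" by (rule trace_nondegenerate[of 1]) simp_all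
  moreover have "1 \<in> M" by (simp add: M_def)
  ultimately obtain w where w: "w \<in> M" "\<And>v. v \<in> M \<Longrightarrow> Tr (a * v) = of_bool (v \<noteq> w)"
    using trace_pattern[of a] by force
  have "Tr (a * (w * inverse u) * v) = of_bool (v \<noteq> u)" if "v \<in> M" for v
  proof -
    have "w * inverse u * v \<in> M" using w(1) assms that by (intro M_closed)
    then have "Tr (a * (w * inverse u * v)) = of_bool (w * inverse u * v \<noteq> w)" by (rule w(2))
    moreover have "w * inverse u * v = w \<longleftrightarrow> v = u"
      using M_closed(3)[OF w(1)] M_closed(3)[OF assms] by (auto simp: field_simps)
    ultimately show ?thesis by (simp only: mult.assoc)
  qed
  then show ?thesis by (rule that)
qed

lemma range_Y_not_3_dvd: "range Y = insert {} ((\<lambda>w. D - fibre w) ` M)"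
proof (intro subset_antisym subsetI)
  fix X assume "X \<in> range Y"
  then obtain a where X: "X = {x \<in> D. Tr (a * x ^ d) = 1}" by (auto simp: Y_def)
  from trace_pattern[of a] show "X \<in> insert {} ((\<lambda>w. D - fibre w) ` M)"
  proof
    assume "\<forall>v\<in>M. Tr (a * v) = 0"
    then show ?thesis using power_d_in_M by (auto simp: X)
  next
    assume "\<exists>w\<in>M. \<forall>v\<in>M. Tr (a * v) = of_bool (v \<noteq> w)"
    then obtain w where "w \<in> M" "\<forall>v\<in>M. Tr (a * v) = of_bool (v \<noteq> w)" by blast
    then have "X = D - fibre w" using power_d_in_M by (auto simp: X fibre_def)
    with \<open>w \<in> M\<close> show ?thesis by blast
  qed
next
  fix X assume "X \<in> insert {} ((\<lambda>w. D - fibre w) ` M)"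
  then show "X \<in> range Y"
  proof
    assume "X = {}"
    then show ?thesis using empty_in_\<Y> by simp
  next
    assume "X \<in> (\<lambda>w. D - fibre w) ` M"
    then obtain w where "w \<in> M" and X: "X = D - fibre w" by blast
    obtain a where "\<And>v. v \<in> M \<Longrightarrow> Tr (a * v) = of_bool (v \<noteq> w)"
      using trace_pattern_attained[OF \<open>w \<in> M\<close>] by blast
    then have "Y a = X" using power_d_in_M by (auto simp: X fibre_def Y_def)
    then show ?thesis by blast
  qed
qed

lemma fibre_subset: "fibre w \<subseteq> D"
  by (auto simp: fibre_def)

lemma card_Diff_fibre: "w \<in> M \<Longrightarrow> card (D - fibre w) = (Q - 1) * (2 * r)"
proof -
  assume "w \<in> M"
  then have "card (D - fibre w) = N - (Q - 1) * r"
    by (simp only: card_Diff_subset[OF _ fibre_subset] finite card_fibre card_D_eq)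
  also have "\<dots> = (Q - 1) * (2 * r)"
    unfolding N_eq by simp
  finally show ?thesis .
qed

lemma fibre_props: "inj_on (\<lambda>w. D - fibre w) M" "{} \<notin> (\<lambda>w. D - fibre w) ` M"
proof -
  show "inj_on (\<lambda>w. D - fibre w) M"
  proof (rule inj_onI)
    fix v w assume vw: "v \<in> M" "w \<in> M" "D - fibre v = D - fibre w"
    obtain e where e: "e \<in> fibre v" using exists_fibre[OF vw(1)] by blast
    with vw(3) have "e \<notin> D - fibre w" by blast
    with e show "v = w" by (simp add: fibre_def)
  qed
  have "r > 0" using s_ge s_eq by (cases r) auto
  then have "D - fibre w \<noteq> {}" if "w \<in> M" for w
    using card_Diff_fibre[OF that] Q_ge by (intro notI) simp
  then show "{} \<notin> (\<lambda>w. D - fibre w) ` M"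
    by blast
qed

lemma card_range_Y_not_3_dvd: "card (range Y) = 2 ^ 2"
  unfolding range_Y_not_3_dvd card_insert_disjoint[OF finite_imageI[OF finite] fibre_props(2)]
    card_image[OF fibre_props(1)] card_M by simp

text \<open>A nonempty \<open>Y\<close> has \<open>2 * r\<close> cosets inside and \<open>r\<close>
  outside, which gives \<open>(3 * Q / 2 - 2) * r\<close>. The three choices of the missing class
  have equal weights and merge into the factor 3.\<close>

lemma weight_distribution_not_3_dvd:
  "has_weight_distribution D code
    [(0, 1),
     (3 * real Q / 2 * r - real Q / 2, real N),
     ((3 * real Q / 2 - 2) * r + real Q / 2, 2 * real N),
     (3 * real Q / 2 * r, real Q * real Q - 1 - real N),
     ((3 * real Q / 2 - 2) * r, 3 * (real Q * real Q - 1 - real N)),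
     ((3 * real Q / 2 - 2) * r - real Q / 2, real N),
     (2 * real N / 3, 3)]"
  (is "has_weight_distribution D code ?tab")
proof -
  have "base_weight {} = real Q / 2 * real s"
    using base_weight_eq[of "{}" s 0] by (simp add: card_D_eq)
  moreover have "real s = 3 * real r" unfolding s_eq by simp
  ultimately have base: "base_weight {} = 3 * real Q / 2 * r" by simp
  have base': "base_weight (D - fibre w) = (3 * real Q / 2 - 2) * r" if "w \<in> M" for w
  proof -
    have "D - (D - fibre w) = fibre w" by (auto simp: fibre_def)
    then have "base_weight (D - fibre w) = real Q / 2 * real r + (real Q - 2) / 2 * real (2 * r)"
      using that by (intro base_weight_eq) (simp_all only: card_fibre card_Diff_fibre)
    then show ?thesis by (simp add: field_simps)
  qed
  have Q2: "2 ^ m = real Q * real Q"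
    using two_power_m by (metis of_nat_mult of_nat_numeral of_nat_power)
  define n where "n = real ((Q - 1) * r)"
  have N: "real N = 3 * n" unfolding N_eq n_def by simp
  have card_D: "real (card D) = 3 * n" by (simp only: card_D_eq N)
  have card: "real (card (D - fibre w)) = 2 * n" "real (card (D - (D - fibre w))) = n" if "w \<in> M" for w
  proof -
    have "D - (D - fibre w) = fibre w" by (auto simp: fibre_def)
    then show "real (card (D - fibre w)) = 2 * n" "real (card (D - (D - fibre w))) = n"
      by (simp_all add: card_fibre card_Diff_fibre that n_def del: One_nat_def)
  qed
  show ?thesis
    unfolding has_weight_distribution_def
  proof
    fix w :: real
    define e where "e v = (of_bool (v = w) :: real)" for v
    have if_eq: "(if v = w then \<mu> else 0) = \<mu> * e v" for v \<mu> :: real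
      by (simp add: e_def)
    have "(\<Sum>X\<in>range Y. g X) = g {} + (\<Sum>w\<in>M. g (D - fibre w))" for g :: "'a set \<Rightarrow> real"
      unfolding range_Y_not_3_dvd sum.insert[OF finite_imageI[OF finite] fibre_props(2)]
        sum.reindex[OF fibre_props(1)] by simp
    then have "real (card {c \<in> code. real (hamming_weight D c) = w}) =
      e 0 + 3 * n * e (3 * real Q / 2 * r - real Q / 2) + (real Q * real Q - 1 - 3 * n) * e (3 * real Q / 2 * r)
      + (\<Sum>w\<in>M. e (2 * n) + n * e ((3 * real Q / 2 - 2) * r - real Q / 2)
        + 2 * n * e ((3 * real Q / 2 - 2) * r + real Q / 2)
        + (real Q * real Q - 1 - 3 * n) * e ((3 * real Q / 2 - 2) * r))"
      by (simp add: card_code_weight base base' card card_D Q2 cong: sum.cong flip: e_def)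
    also have "\<dots> = (\<Sum>(v, \<mu>) \<leftarrow> ?tab. if v = w then \<mu> else 0)"
    proof -
      have "2 * (3 * n) / 3 = 2 * n" by simp
      moreover have "x + 3 * n * y + c * z + 3 * (x' + n * y' + 2 * n * z' + c * u)
        = x + (3 * n * y + (2 * (3 * n) * z' + (c * z + (3 * c * u + (3 * n * y' + (3 * x' + 0))))))"
        for x y z x' y' z' c u :: real
        by (simp add: algebra_simps)
      ultimately show ?thesis
        by (simp only: if_eq list.map prod.case sum_list.Cons sum_list.Nil N sum_constant card_M
            of_nat_numeral mult_1_left)
    qed
    finally show "real (card {c \<in> code. real (hamming_weight D c) = w})
      = (\<Sum>(v, \<mu>) \<leftarrow> ?tab. if v = w then \<mu> else 0)" .
  qed
qed

text \<open>
  Any two elements of distinct cubic classes span the field over its quadratic subfield, whose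
  nonzero elements all have trivial class. A linear relation between three representatives of the
  three classes therefore yields a dual word of weight 3.
\<close>

lemma exists_dual_weight_3:
  obtains u where "u \<in> dual_code D code" "hamming_weight D u = 3"
proof -
  have K_d: "k ^ d = 1" if "k \<in> K" for k
    by (rule K_power[OF that]) (simp add: d_eq)
  obtain x1 x2 x3 where x: "x1 \<in> fibre 1" "x2 \<in> fibre \<omega>" "x3 \<in> fibre (\<omega> ^ 2)"
    using exists_fibre by (metis M_def insertI1 insertI2)
  then have x0: "x1 \<noteq> 0" "x2 \<noteq> 0" "x3 \<noteq> 0"
    using D_nonzero by (auto simp: fibre_def)
  have "x1 / x2 \<notin> K"
  proof
    assume "x1 / x2 \<in> K"
    from K_d[OF this] show False
      using x omega_ne_1 by (simp add: fibre_def power_divide)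
  qed
  then obtain a b where ab: "a \<in> insert 0 K" "b \<in> insert 0 K" "x3 = a * x1 + b * x2"
    using x0 by (metis subfield_combination)
  have "a \<noteq> 0"
  proof
    assume "a = 0"
    then have "x3 = b * x2" "b \<in> K" using ab x0 by auto
    then have "x3 ^ d = x2 ^ d" by (simp add: power_mult_distrib K_d)
    then show False using x omega_distinct by (simp add: fibre_def)
  qed
  moreover have "b \<noteq> 0"
  proof
    assume "b = 0"
    then have "x3 = a * x1" "a \<in> K" using ab x0 by auto
    then have "x3 ^ d = x1 ^ d" by (simp add: power_mult_distrib K_d)
    then show False using x omega_distinct by (simp add: fibre_def)
  qed
  ultimately have K: "a \<in> K" "b \<in> K" using ab by auto
  \<comment> \<open>Scaling by elements of \<open>K\<close> keeps the cubic class, so the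
    coefficients can be absorbed into the representatives.\<close>
  define y1 y2 where "y1 = x1 * a" and "y2 = x2 * b"
  have y: "y1 \<in> fibre 1" "y2 \<in> fibre \<omega>"
    using x K D_stable by (auto simp: fibre_def y1_def y2_def K_stable_mult_iff power_mult_distrib K_d)
  have "y1 + y2 = x3"
    using ab(3) by (simp add: y1_def y2_def mult.commute)
  then have sum: "y1 + (y2 + x3) = 0"
    by (simp only: add.assoc[symmetric] add_self)
  have in_D: "y1 \<in> D" "y2 \<in> D" "x3 \<in> D"
    and cls: "y1 ^ d = 1" "y2 ^ d = \<omega>" "x3 ^ d = \<omega> ^ 2"
    using x y by (simp_all add: fibre_def)
  have ne: "y1 \<noteq> y2" "y1 \<noteq> x3" "y2 \<noteq> x3"
    using cls omega_ne_1 omega_distinct by auto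
  define u :: "'a \<Rightarrow> bit" where "u x = of_bool (x \<in> {y1, y2, x3})" for x
  have supp: "{x \<in> D. u x = 1} = {y1, y2, x3}"
    using in_D by (auto simp: u_def)
  have words: "u \<in> words D"
    using in_D by (auto simp: words_def u_def)
  have "even (card {x \<in> X. u x = 1})" if "X \<in> range Y" for X
  proof -
    have *: "{x \<in> X. u x = 1} = {y1, y2, x3} \<inter> X"
      by (auto simp: u_def)
    \<comment> \<open>A nonempty \<open>X\<close> omits exactly one class, hence exactly one of the
      three elements.\<close>
    have "card ({y1, y2, x3} \<inter> X) \<in> {0, 2}"
    proof -
      have "{y1, y2, x3} \<inter> (D - fibre 1) = {y2, x3}" "{y1, y2, x3} \<inter> (D - fibre \<omega>) = {y1, x3}"
        "{y1, y2, x3} \<inter> (D - fibre (\<omega> ^ 2)) = {y1, y2}"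
        using omega_ne_1 omega_distinct omega_ne_1[symmetric] omega_distinct[symmetric]
        by (simp_all add: fibre_def in_D cls)
      moreover have "X = {} \<or> X = D - fibre 1 \<or> X = D - fibre \<omega> \<or> X = D - fibre (\<omega> ^ 2)"
        using that unfolding range_Y_not_3_dvd M_def by simp
      ultimately show ?thesis
        using ne by (elim disjE) simp_all
    qed
    then show ?thesis unfolding * by auto
  qed
  then have "u \<in> dual_code D code"
    unfolding dual_code_iff[OF words] supp using sum ne by simp
  moreover have "hamming_weight D u = 3"
    unfolding hamming_weight_eq supp using ne by simp
  ultimately show ?thesis by (rule that)
qed

lemma min_distance_dual_3: "has_min_distance D (dual_code D code) 3"
proof -
  obtain u where u: "u \<in> dual_code D code" "hamming_weight D u = 3"
    by (rule exists_dual_weight_3)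
  then have "u \<noteq> 0" by (auto simp: hamming_weight_def)
  with u show ?thesis
    using dual_weight_ge_3 by (intro has_min_distanceI subspace_dual_code)
qed

end

end

section \<open>Weight tables and conclusion\<close>

text \<open>Substituting \<open>q + 1 = T * S\<close> cancels the denominators, because
  \<open>q * q - 1\<close> is \<open>(q - 1) * (T * S)\<close>. The equations serve as rewrite rules
  from the stated table to the computed one.\<close>

lemma table_entries_3_dvd:
  fixes T S q :: real
  assumes "T > 0" and q: "q = T * S - 1"
  shows "1 / (2 * T) * (q * q - 2 - q) = (q - 2) / 2 * S"
    and "(T - 1) * (q * q - 1) / T = q * q - 1 - (q - 1) * S"
    and "1 / (2 * T) * (q * q + q) = q / 2 * S"
    and "1 / (2 * T) * (q * q - 2 + (T - 1) * q) = (q - 2) / 2 * S + q / 2"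
    and "(q * q - 1) / T = (q - 1) * S"
    and "1 / (2 * T) * (q * q - (T - 1) * q) = q / 2 * S - q / 2"
  using assms(1) unfolding q by (simp_all add: field_simps)

lemma table_entries_not_3_dvd:
  fixes T R q :: real
  assumes "T > 0" and q: "q = T * (3 * R) - 1"
  shows "(q * q - 1) / (2 * T) - 1 / (2 * T) * ((T - 1) * q - 1) = 3 * q / 2 * R - q / 2"
    and "(q * q - 1) / T = (q - 1) * (3 * R)"
    and "(q * q - 1) / (2 * T) + 1 / (6 * T) * ((3 * T - 1) * q - 1) = (3 * q / 2 - 2) * R + q / 2"
    and "(2 * (q * q) - 2) / T = 2 * ((q - 1) * (3 * R))"
    and "1 / (2 * T) * (q * q + q) = 3 * q / 2 * R"
    and "(T - 1) * (q * q - 1) / T = q * q - 1 - (q - 1) * (3 * R)"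
    and "(q * q - 1) / (2 * T) - 1 / (6 * T) * (q + 1) = (3 * q / 2 - 2) * R"
    and "3 * (T - 1) * (q * q - 1) / T = 3 * (q * q - 1 - (q - 1) * (3 * R))"
    and "(q * q - 1) / (2 * T) - 1 / (6 * T) * ((3 * T + 1) * q + 1) = (3 * q / 2 - 2) * R - q / 2"
    and "2 * (q * q - 1) / (3 * T) = 2 * ((q - 1) * (3 * R)) / 3"
  using assms(1) unfolding q by (simp_all add: field_simps)

theorem theorem5p2:
  fixes \<gamma> :: "'a::finite_field" and m t d :: nat
    and D :: "'a set" and C :: "('a \<Rightarrow> bit) set"
  assumes "CARD('a) = 2 ^ m"
    and "m \<ge> 4" and "multiplicity 2 m = 1"
    and "d = (2 ^ m - 1) div 3"
    and "t > 0" and "lcm 3 t dvd 2 ^ (m div 2) + 1" and "t \<noteq> 2 ^ (m div 2) + 1"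
    and "primitive_element \<gamma>"
    and "D = cyclic_subgroup (\<gamma> ^ t)"
    and "C = trace_code m (\<lambda>x. x ^ d) D"
  shows "(3 dvd t \<longrightarrow>
      binary_code D ((2 ^ m - 1) div t) (m + 1) C \<and>
      has_weight_distribution D C
        [(0, 1),
         (1 / (2 * real t) * (2 ^ m - 2 - 2 ^ (m div 2)), (real t - 1) * (2 ^ m - 1) / real t),
         (1 / (2 * real t) * (2 ^ m + 2 ^ (m div 2)), (real t - 1) * (2 ^ m - 1) / real t),
         (1 / (2 * real t) * (2 ^ m - 2 + (real t - 1) * 2 ^ (m div 2)), (2 ^ m - 1) / real t),
         (1 / (2 * real t) * (2 ^ m - (real t - 1) * 2 ^ (m div 2)), (2 ^ m - 1) / real t),
         ((2 ^ m - 1) / real t, 1)] \<and>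
      binary_code_dist D ((2 ^ m - 1) div t) ((2 ^ m - 1) div t - m - 1) 4 (dual_code D C) \<and>
      distance_optimal D (dual_code D C)) \<and>
    (\<not> 3 dvd t \<longrightarrow>
      binary_code D ((2 ^ m - 1) div t) (m + 2) C \<and>
      has_weight_distribution D C
        [(0, 1),
         ((2 ^ m - 1) / (2 * real t) - 1 / (2 * real t) * ((real t - 1) * 2 ^ (m div 2) - 1),
            (2 ^ m - 1) / real t),
         ((2 ^ m - 1) / (2 * real t) + 1 / (6 * real t) * ((3 * real t - 1) * 2 ^ (m div 2) - 1),
            (2 ^ (m + 1) - 2) / real t),
         (1 / (2 * real t) * (2 ^ m + 2 ^ (m div 2)), (real t - 1) * (2 ^ m - 1) / real t),
         ((2 ^ m - 1) / (2 * real t) - 1 / (6 * real t) * (2 ^ (m div 2) + 1),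
            3 * (real t - 1) * (2 ^ m - 1) / real t),
         ((2 ^ m - 1) / (2 * real t) - 1 / (6 * real t) * ((3 * real t + 1) * 2 ^ (m div 2) + 1),
            (2 ^ m - 1) / real t),
         (2 * (2 ^ m - 1) / (3 * real t), 3)] \<and>
      binary_code_dist D ((2 ^ m - 1) div t) ((2 ^ m - 1) div t - m - 2) 3 (dual_code D C))"
proof -
  define h where "h = m div 2"
  have "even m"
    using assms(3) by (metis not_dvd_imp_multiplicity_0 zero_neq_one)
  then have m: "m = 2 * h" by (simp add: h_def)
  interpret quadratic_binary_field m "TYPE('a)" \<gamma> h
    by unfold_locales (use assms m in auto)
  have Q: "Q = 2 ^ (m div 2)" by (simp only: Q_def) (simp only: h_def)
  have dvd: "t dvd Q + 1" "3 dvd Q + 1"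
    using assms(6) unfolding Q by (auto intro: dvd_trans[OF dvd_lcm1] dvd_trans[OF dvd_lcm2])
  obtain s where ts: "t * s = Q + 1" using dvd(1) by (metis dvdE)
  have "s \<noteq> 0" using ts by (intro notI) simp
  moreover have "s \<noteq> 1" using ts assms(7) by (auto simp: Q)
  ultimately have "s \<ge> 2" by simp
  have "3 dvd (2 ^ m - 1 :: nat)"
    unfolding card_units using dvd(2) by (rule dvd_mult)
  then have "3 * d = 2 ^ m - 1" by (simp only: assms(4) dvd_mult_div_cancel)
  interpret c: subgroup_trace_code m "TYPE('a)" \<gamma> h t s d
    by unfold_locales (fact ts \<open>s \<ge> 2\<close> \<open>3 * d = 2 ^ m - 1\<close> dvd)+
  have D: "D = c.D" using assms(9) c.D_eq by simp
  have C: "C = c.code" using assms(10) D c.code_eq by simp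
  have N: "(2 ^ m - 1) div t = c.N"
    using assms(5) by (simp only: c.N_t[symmetric] nonzero_mult_div_cancel_right)
  have q: "(2 :: real) ^ (m div 2) = real Q" by (simp add: Q)
  have q2: "(2 :: real) ^ m = real Q * real Q"
    unfolding q[symmetric] using m by (simp add: h_def flip: power_add mult_2)
  have q2': "(2 :: real) ^ (m + 1) = 2 * (real Q * real Q)"
    using q2 by simp
  have ts_real: "real Q = real t * real s - 1"
    using ts by (metis add_diff_cancel_right' of_nat_1 of_nat_add of_nat_mult)
  have t_pos: "real t > 0" using assms(5) by simp
  have "binary_code D ((2 ^ m - 1) div t) (m + 1) C \<and>
      has_weight_distribution D C
        [(0, 1),
         (1 / (2 * real t) * (2 ^ m - 2 - 2 ^ (m div 2)), (real t - 1) * (2 ^ m - 1) / real t),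
         (1 / (2 * real t) * (2 ^ m + 2 ^ (m div 2)), (real t - 1) * (2 ^ m - 1) / real t),
         (1 / (2 * real t) * (2 ^ m - 2 + (real t - 1) * 2 ^ (m div 2)), (2 ^ m - 1) / real t),
         (1 / (2 * real t) * (2 ^ m - (real t - 1) * 2 ^ (m div 2)), (2 ^ m - 1) / real t),
         ((2 ^ m - 1) / real t, 1)] \<and>
      binary_code_dist D ((2 ^ m - 1) div t) ((2 ^ m - 1) div t - m - 1) 4 (dual_code D C) \<and>
      distance_optimal D (dual_code D C)" if t3: "3 dvd t"
  proof (intro conjI)
    note codes = c.binary_code_code[OF c.card_range_Y_3_dvd[OF t3]]
    show "binary_code D ((2 ^ m - 1) div t) (m + 1) C"
      using codes(1) by (simp only: D C N c.card_D_eq)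
    show "binary_code_dist D ((2 ^ m - 1) div t) ((2 ^ m - 1) div t - m - 1) 4 (dual_code D C)"
      using codes(2) c.min_distance_dual_4[OF t3]
      by (simp only: D C N c.card_D_eq binary_code_dist_def diff_diff_left simp_thms)
    show "distance_optimal D (dual_code D C)"
      using c.dual_distance_optimal[OF t3] by (simp only: D C)
    show "has_weight_distribution D C
        [(0, 1),
         (1 / (2 * real t) * (2 ^ m - 2 - 2 ^ (m div 2)), (real t - 1) * (2 ^ m - 1) / real t),
         (1 / (2 * real t) * (2 ^ m + 2 ^ (m div 2)), (real t - 1) * (2 ^ m - 1) / real t),
         (1 / (2 * real t) * (2 ^ m - 2 + (real t - 1) * 2 ^ (m div 2)), (2 ^ m - 1) / real t),
         (1 / (2 * real t) * (2 ^ m - (real t - 1) * 2 ^ (m div 2)), (2 ^ m - 1) / real t),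
         ((2 ^ m - 1) / real t, 1)]"
      unfolding q q2 table_entries_3_dvd[OF t_pos ts_real] D C
      using c.weight_distribution_3_dvd[OF t3] by (simp only: c.real_N)
  qed
  moreover have "binary_code D ((2 ^ m - 1) div t) (m + 2) C \<and>
      has_weight_distribution D C
        [(0, 1),
         ((2 ^ m - 1) / (2 * real t) - 1 / (2 * real t) * ((real t - 1) * 2 ^ (m div 2) - 1),
            (2 ^ m - 1) / real t),
         ((2 ^ m - 1) / (2 * real t) + 1 / (6 * real t) * ((3 * real t - 1) * 2 ^ (m div 2) - 1),
            (2 ^ (m + 1) - 2) / real t),
         (1 / (2 * real t) * (2 ^ m + 2 ^ (m div 2)), (real t - 1) * (2 ^ m - 1) / real t),
         ((2 ^ m - 1) / (2 * real t) - 1 / (6 * real t) * (2 ^ (m div 2) + 1),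
            3 * (real t - 1) * (2 ^ m - 1) / real t),
         ((2 ^ m - 1) / (2 * real t) - 1 / (6 * real t) * ((3 * real t + 1) * 2 ^ (m div 2) + 1),
            (2 ^ m - 1) / real t),
         (2 * (2 ^ m - 1) / (3 * real t), 3)] \<and>
      binary_code_dist D ((2 ^ m - 1) div t) ((2 ^ m - 1) div t - m - 2) 3 (dual_code D C)"
    if t3: "\<not> 3 dvd t"
  proof (intro conjI)
    obtain r where r: "s = 3 * r" using c.three_dvd_s[OF t3] by (elim dvdE)
    have tr_real: "real Q = real t * (3 * real r) - 1"
      using ts_real r by simp
    have N_real: "real c.N = (real Q - 1) * (3 * real r)"
      unfolding c.real_N by (simp add: r)
    note codes = c.binary_code_code[OF c.card_range_Y_not_3_dvd[OF t3 r]]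
    show "binary_code D ((2 ^ m - 1) div t) (m + 2) C"
      using codes(1) by (simp only: D C N c.card_D_eq)
    show "binary_code_dist D ((2 ^ m - 1) div t) ((2 ^ m - 1) div t - m - 2) 3 (dual_code D C)"
      using codes(2) c.min_distance_dual_3[OF t3 r]
      by (simp only: D C N c.card_D_eq binary_code_dist_def diff_diff_left simp_thms)
    show "has_weight_distribution D C
        [(0, 1),
         ((2 ^ m - 1) / (2 * real t) - 1 / (2 * real t) * ((real t - 1) * 2 ^ (m div 2) - 1),
            (2 ^ m - 1) / real t),
         ((2 ^ m - 1) / (2 * real t) + 1 / (6 * real t) * ((3 * real t - 1) * 2 ^ (m div 2) - 1),
            (2 ^ (m + 1) - 2) / real t),
         (1 / (2 * real t) * (2 ^ m + 2 ^ (m div 2)), (real t - 1) * (2 ^ m - 1) / real t),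
         ((2 ^ m - 1) / (2 * real t) - 1 / (6 * real t) * (2 ^ (m div 2) + 1),
            3 * (real t - 1) * (2 ^ m - 1) / real t),
         ((2 ^ m - 1) / (2 * real t) - 1 / (6 * real t) * ((3 * real t + 1) * 2 ^ (m div 2) + 1),
            (2 ^ m - 1) / real t),
         (2 * (2 ^ m - 1) / (3 * real t), 3)]"
      unfolding q q2 q2' table_entries_not_3_dvd[OF t_pos tr_real] D C
      using c.weight_distribution_not_3_dvd[OF t3 r] by (simp only: N_real)
  qed
  ultimately show ?thesis by blast
qed

end
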